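(* Let $\epsilon>0$. If for some $\delta>1$, $\max_{1\leq n \leq N}\Delta t_n\leq \left( \delta\,\lambda^S\,\Gamma(2-\alpha)\right)^{-1/\alpha}$, then the solution $u_h^n$ of the fully discrete IMEX-L1 mixed finite element scheme (described in the context) satisfies $$\|u_h^n\| \leq C_S\, E_{\alpha}(C_\delta \Lambda_{\infty}^S t_n^{\alpha})\left( \|u_h^0\| + \max_{1\leq j \leq n} \sum_{i=1}^jP_{\alpha}^{j,i}\|Ef^i\|\right), \quad 1 \leq n \leq N,$$ where $C_S:=2C_\delta$, $C_\delta := \delta/(\delta-1)$, $$\lambda^S:= \tfrac{1}{2}\|\widetilde{b}\|_{L^\infty(\Omega\times J)} + 2\|\widetilde{c}\|_{L^\infty(\Omega\times J)} + \epsilon|\lambda |,\qquad \widetilde{c}:= \max(0,-c),\quad \widetilde{b}:=\boldsymbol{b}^T\boldsymbol{A}^{-1}\boldsymbol{b},$$ $$\Lambda^S :=\Big( \tfrac{1}{2}\|\widetilde{b}\|_{L^\infty(\Omega\times J)} + 2\|\widetilde{c}\|_{L^\infty(\Omega\times J)} + \epsilon|\lambda |\Big) + 2\epsilon^{-1}|\lambda |C_{\mathcal{I}}^2\left((1+\mu_{n_\alpha+1})^2+\mu_{n_\alpha+1}^2\right),$$ $$\Lambda_{\infty}^S:=\lim_{n\to\infty}\Lambda_{n}^S,\qquad \Lambda_{n}^S:=\begin{cases}\Lambda^S, & 1\leq n \leq n_\alpha:=\min\left(\lfloor 1/\alpha\rfloor,N\right),\\ \Lambda^S\Big(1+\max\limits_{n_\alpha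 +1\leq j \leq n}\dfrac{P_\alpha^{j,j}}{P_\alpha^{j,j-1}}\Big), & n\ge n_\alpha + 1.\end{cases}$$
   Context: **Problem data.** $0<\alpha<1$; $J=(0,T]$, $0<T<\infty$; $\Omega\subset\mathbb R^d$ ($d=1,2,3$) is a bounded convex polygonal or polyhedral domain; $\lambda\in\mathbb R$. The underlying problem is $\partial_t^\alpha u-\nabla\cdot(\boldsymbol A\nabla u)+\boldsymbol b\cdot\nabla u+cu-\lambda\mathcal Iu=f$ in $\Omega\times J$, $u=0$ on $\partial\Omega\times J$, $u(\cdot,0)=u_0$, with $\partial_t^\alpha$ the Caputo derivative and $\mathcal Iu(\cdot,t)=\int_\Omega u(\boldsymbol y,t)g(\cdot,\boldsymbol y)\,d\boldsymbol y$; $\boldsymbol A,\boldsymbol b,c$ depend on $(\boldsymbol x,t)$. $\boldsymbol A$ is real symmetric with $\kappa_0\|\boldsymbol y\|^2\le\boldsymbol y^T\boldsymbol A\boldsymbol y\le\kappa_1\|\boldsymbol y\|^2$, $\kappa_0,\kappa_1>0$. Standing assumptions: $f\in W^{3,1}(J;L^2(\Omega))\cap W^{2,1}(J;H^1(\Omega))$; $u_0\in H_0^1(\Omega)\cap H^2(\Omega)$; $\|\mathcal I\phi\|_j\le C_{\mathcal I}\|\phi\|_j$ for $\phi\in H_0^j(\Omega)$, $j=0,1$ ($H_0^0=L^2$); for $k=0,1,2,3$, $t\in J$: $\|\partial_t^k\boldsymbol A(\cdot,t)\|_{W^{1,\infty}}\le C_{\boldsymbol A}$, $\|\partial_t^k\boldsymbol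 b(\cdot,t)\|_{L^\infty}\le C_{\boldsymbol b}$, $\|\partial_t^kc(\cdot,t)\|_{L^\infty}\le C_c$. $\boldsymbol B:=\boldsymbol A^{-1}$. $\|\cdot\|$ and $(\cdot,\cdot)$ are the $L^2$ norm and inner product, $\|\cdot\|_j$ the $H^j$ norm. **Finite element spaces.** $\mathcal T_h$ is a regular family of decompositions of $\Omega$ into closed $d$-simplexes of maximal diameter $h$; $V_h\times\boldsymbol W_h$ is a finite element subspace of $L^2(\Omega)\times H(\mathrm{div};\Omega)$ with (i) $\nabla\cdot\boldsymbol W_h\subseteq V_h$; (ii) there is a Fortin projection $\Pi_h:H(\mathrm{div};\Omega)\to\boldsymbol W_h$ with $\nabla\cdot\Pi_h=P_h(\nabla\cdot)$, $P_h$ the $L^2$-projection onto $V_h$; (iii) $\|\boldsymbol w-\Pi_h\boldsymbol w\|\le Ch^r\|\nabla\cdot\boldsymbol w\|_{r-1}$, $\|v-P_hv\|+h\|v-P_hv\|_1\le Ch^r\|v\|_r$, $1\le r\le2$. **Time mesh and kernels.** $t_n=(n/N)^\gamma T$, $\gamma\ge1$; $\Delta t_n=t_n-t_{n-1}$; $\mu_n=\Delta t_n/\Delta t_{n-1}$; $k_\beta(t)=t^{\beta-1}/\Gamma(\beta)$; $K_{1-\alpha}^{n,j}=\frac1{\Delta t_j}\int_{t_{j-1}}^{t_j}k_{1-\alpha}(t_n-s)\,ds$; $D_{t_n}^\alpha\phi^n=\sum_{j=1}^nK_{1-\alpha}^{n,j}(\phi^j-\phi^{j-1})$; $P_\alpha^{n,n}=1/K_{1-\alpha}^{n,n}$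 and $P_\alpha^{n,i}=\frac1{K_{1-\alpha}^{i,i}}\sum_{j=i+1}^nP_\alpha^{n,j}(K_{1-\alpha}^{j,i+1}-K_{1-\alpha}^{j,i})$ for $1\le i\le n-1$. For the limit $\Lambda_\infty^S$ and for $\mu_{n_\alpha+1}$, the mesh formula $t_n=(n/N)^\gamma T$ and the kernels are extended to all integers $n\ge0$ by the same formulas. $E_\alpha(z)=\sum_{j\ge0}z^j/\Gamma(j\alpha+1)$. **Scheme.** Find $(u_h^n,\boldsymbol\sigma_h^n)\in V_h\times\boldsymbol W_h$, $0\le n\le N$, with $u_h^0=P_hu_0$, $(\boldsymbol B^n\boldsymbol\sigma_h^n,\boldsymbol w_h)+(u_h^n,\nabla\cdot\boldsymbol w_h)=0$ for all $\boldsymbol w_h\in\boldsymbol W_h$, $0\le n\le N$, and $(D_{t_n}^\alpha u_h^n,v_h)-(\nabla\cdot\boldsymbol\sigma_h^n,v_h)+(\boldsymbol b^n\cdot\boldsymbol B^n\boldsymbol\sigma_h^n,v_h)+(c^nu_h^n,v_h)=\lambda(\mathcal IEu_h^n,v_h)+(Ef^n,v_h)$ for all $v_h\in V_h$, $1\le n\le N$. A superscript $n$ on $\boldsymbol B,\boldsymbol b,c,f$ denotes evaluation at $t_n$, and $E\phi^n=\phi^{n-1}$ for $1\le n\le n_\alpha$, $E\phi^n=(1+\mu_n)\phi^{n-1}-\mu_n\phi^{n-2}$ for $n\ge n_\alpha+1$. If $\lambda^S=0$ the time-step restriction is void. *)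

theory Defs
  imports "HOL-Analysis.Analysis" "HOL-Probability.Essential_Supremum"
begin

section \<open>Lebesgue and Sobolev spaces\<close>

text \<open>Elements of function spaces are represented by functions on the whole type; only their values
  on the domain matter, and only up to null sets.\<close>

definition ae_eq :: "'a::euclidean_space set \<Rightarrow> ('a \<Rightarrow> 'b) \<Rightarrow> ('a \<Rightarrow> 'b) \<Rightarrow> bool" where
  "ae_eq U f g \<longleftrightarrow> (AE x in lebesgue_on U. f x = g x)"

definition L2 :: "'a::euclidean_space set \<Rightarrow> ('a \<Rightarrow> 'b::euclidean_space) set" where
  "L2 U = {f. f \<in> borel_measurable (lebesgue_on U) \<and>
              integrable (lebesgue_on U) (\<lambda>x. (norm (f x))\<^sup>2)}"

definition l2ip :: "'a::euclidean_space set \<Rightarrow> ('a \<Rightarrow> 'b::euclidean_space) \<Rightarrow> ('a \<Rightarrow> 'b) \<Rightarrow> real" where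
  "l2ip U f g = (\<integral>x. f x \<bullet> g x \<partial>lebesgue_on U)"

definition l2norm :: "'a::euclidean_space set \<Rightarrow> ('a \<Rightarrow> 'b::euclidean_space) \<Rightarrow> real" where
  "l2norm U f = sqrt (l2ip U f f)"

definition Linf_norm :: "'a measure \<Rightarrow> ('a \<Rightarrow> 'b::real_normed_vector) \<Rightarrow> ereal" where
  "Linf_norm M f =
     (if f \<in> borel_measurable M then esssup M (\<lambda>x. ereal (norm (f x))) else \<infinity>)"

fun iter_deriv :: "'a::euclidean_space list \<Rightarrow> ('a \<Rightarrow> real) \<Rightarrow> 'a \<Rightarrow> real" where
  "iter_deriv [] \<phi> = \<phi>"
| "iter_deriv (i # ds) \<phi> = (\<lambda>x. frechet_derivative (iter_deriv ds \<phi>) (at x) i)"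

definition smooth :: "('a::euclidean_space \<Rightarrow> real) \<Rightarrow> bool" where
  "smooth \<phi> \<longleftrightarrow> (\<forall>ds x. set ds \<subseteq> Basis \<longrightarrow> iter_deriv ds \<phi> differentiable (at x))"

definition test_fun :: "'a::euclidean_space set \<Rightarrow> ('a \<Rightarrow> real) set" where
  "test_fun U = {\<phi>. smooth \<phi> \<and> compact (closure {x. \<phi> x \<noteq> 0}) \<and> closure {x. \<phi> x \<noteq> 0} \<subseteq> U}"

definition loc_integrable :: "'a::euclidean_space set \<Rightarrow> ('a \<Rightarrow> 'b::euclidean_space) \<Rightarrow> bool" where
  "loc_integrable U f \<longleftrightarrow> (\<forall>K. compact K \<and> K \<subseteq> U \<longrightarrow> f absolutely_integrable_on K)"

text \<open>A list of basis vectors plays the role of a multi-index: the partial derivatives are taken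
  successively in the listed directions.\<close>

definition has_weak_deriv ::
    "'a::euclidean_space set \<Rightarrow> 'a list \<Rightarrow> ('a \<Rightarrow> real) \<Rightarrow> ('a \<Rightarrow> real) \<Rightarrow> bool" where
  "has_weak_deriv U ds f g \<longleftrightarrow> loc_integrable U f \<and> loc_integrable U g \<and>
     (\<forall>\<phi>\<in>test_fun U. l2ip U f (iter_deriv ds \<phi>) = (- 1) ^ length ds * l2ip U g \<phi>)"

definition wderiv :: "'a::euclidean_space set \<Rightarrow> 'a list \<Rightarrow> ('a \<Rightarrow> real) \<Rightarrow> 'a \<Rightarrow> real" where
  "wderiv U ds f = (if ds = [] then f else (SOME g. has_weak_deriv U ds f g))"

definition wgrad :: "'a::euclidean_space set \<Rightarrow> ('a \<Rightarrow> real) \<Rightarrow> 'a \<Rightarrow> 'a" where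
  "wgrad U f x = (\<Sum>i\<in>Basis. wderiv U [i] f x *\<^sub>R i)"

definition sobolev :: "nat \<Rightarrow> 'a::euclidean_space set \<Rightarrow> ('a \<Rightarrow> real) set" where
  "sobolev m U = {f \<in> L2 U. \<forall>ds. set ds \<subseteq> Basis \<and> length ds \<le> m \<longrightarrow>
                     (\<exists>g\<in>L2 U. has_weak_deriv U ds f g)}"

text \<open>Exactly the usual norm for \<^term>\<open>m \<le> (1::nat)\<close>; for larger \<^term>\<open>m\<close> a mixed derivative is
  counted once per ordering of the directions, which gives an equivalent norm.\<close>

definition sob_norm :: "nat \<Rightarrow> 'a::euclidean_space set \<Rightarrow> ('a \<Rightarrow> real) \<Rightarrow> real" where
  "sob_norm m U f =
     sqrt (\<Sum>ds\<in>{ds. set ds \<subseteq> Basis \<and> length ds \<le> m}. (l2norm U (wderiv U ds f))\<^sup>2)"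

definition H1_0 :: "'a::euclidean_space set \<Rightarrow> ('a \<Rightarrow> real) set" where
  "H1_0 U = {f \<in> sobolev 1 U. \<forall>e>0. \<exists>\<phi>\<in>test_fun U. sob_norm 1 U (\<lambda>x. f x - \<phi> x) < e}"

text \<open>In the following definition the integrand on the left is
  \<open>w \<cdot> \<nabla>\<phi>\<close>, the directional derivative of the test function.\<close>

definition has_weak_div ::
    "'a::euclidean_space set \<Rightarrow> ('a \<Rightarrow> 'a) \<Rightarrow> ('a \<Rightarrow> real) \<Rightarrow> bool" where
  "has_weak_div U w q \<longleftrightarrow> loc_integrable U w \<and> loc_integrable U q \<and>
     (\<forall>\<phi>\<in>test_fun U. (\<integral>x. frechet_derivative \<phi> (at x) (w x) \<partial>lebesgue_on U) = - l2ip U q \<phi>)"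

definition Hdiv :: "'a::euclidean_space set \<Rightarrow> ('a \<Rightarrow> 'a) set" where
  "Hdiv U = {w \<in> L2 U. \<exists>q\<in>L2 U. has_weak_div U w q}"

definition wdiv :: "'a::euclidean_space set \<Rightarrow> ('a \<Rightarrow> 'a) \<Rightarrow> 'a \<Rightarrow> real" where
  "wdiv U w = (SOME q. q \<in> L2 U \<and> has_weak_div U w q)"

definition W1inf_le :: "'a::euclidean_space set \<Rightarrow> real \<Rightarrow> ('a \<Rightarrow> real) \<Rightarrow> bool" where
  "W1inf_le U C f \<longleftrightarrow> Linf_norm (lebesgue_on U) f \<le> ereal C \<and>
     (\<forall>i\<in>Basis. \<exists>g. has_weak_deriv U [i] f g \<and> Linf_norm (lebesgue_on U) g \<le> ereal C)"

text \<open>\<open>W\<^sup>m\<^sup>,\<^sup>1(J; H\<^sup>j(\<Omega>))\<close> with \<open>J = (0,T]\<close>: vector-valued weak time derivatives are expressed as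
  weak derivatives of the function of \<open>(x,t)\<close> on the space-time cylinder.\<close>

definition bochner_W1 ::
    "nat \<Rightarrow> nat \<Rightarrow> 'a::euclidean_space set \<Rightarrow> real \<Rightarrow> ('a \<Rightarrow> real \<Rightarrow> real) \<Rightarrow> bool" where
  "bochner_W1 m j U T f \<longleftrightarrow>
     (\<forall>k\<le>m. \<forall>ds. set ds \<subseteq> Basis \<and> length ds \<le> j \<longrightarrow>
       (\<exists>g. has_weak_deriv (U \<times> {0<..<T}) (replicate k (0, 1) @ map (\<lambda>i. (i, 0)) ds)
               (\<lambda>(x, t). f x t) (\<lambda>(x, t). g x t) \<and>
            (AE t in lebesgue_on {0<..<T}. (\<lambda>x. g x t) \<in> L2 U) \<and>
            integrable (lebesgue_on {0<..<T}) (\<lambda>t. l2norm U (\<lambda>x. g x t))))"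

definition L2_continuous :: "'a::euclidean_space set \<Rightarrow> real \<Rightarrow> ('a \<Rightarrow> real \<Rightarrow> real) \<Rightarrow> bool" where
  "L2_continuous U T f \<longleftrightarrow> (\<forall>t\<in>{0..T}. (\<lambda>x. f x t) \<in> L2 U \<and>
     ((\<lambda>s. l2norm U (\<lambda>x. f x s - f x t)) \<longlongrightarrow> 0) (at t within {0..T}))"


section \<open>Problem data\<close>

definition polytopal_domain :: "'a::euclidean_space set \<Rightarrow> bool" where
  "polytopal_domain U \<longleftrightarrow> open U \<and> U \<noteq> {} \<and> convex U \<and> polytope (closure U)"

definition time_derivs :: "'a::euclidean_space set \<Rightarrow> real \<Rightarrow> ('a \<Rightarrow> real \<Rightarrow> 'b::real_normed_vector)
    \<Rightarrow> (nat \<Rightarrow> 'a \<Rightarrow> real \<Rightarrow> 'b) \<Rightarrow> bool" where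
  "time_derivs U T F D \<longleftrightarrow> D 0 = F \<and>
     (\<forall>k<3. AE x in lebesgue_on U. \<forall>t\<in>{0<..T}.
        (D k x has_vector_derivative D (Suc k) x t) (at t within {0<..T}))"

text \<open>The diffusion matrix is also needed at time \<open>0\<close>, where it is the continuous extension of its
  values on \<open>(0,T]\<close>.\<close>

definition diffusion_matrix ::
    "(real^'n::finite) set \<Rightarrow> real \<Rightarrow> real \<Rightarrow> real \<Rightarrow> real \<Rightarrow> (real^'n \<Rightarrow> real \<Rightarrow> real^'n^'n) \<Rightarrow> bool" where
  "diffusion_matrix U T \<kappa>0 \<kappa>1 C A \<longleftrightarrow>
     (\<lambda>(x, t). A x t) \<in> borel_measurable (lebesgue_on (U \<times> {0<..T})) \<and>
     (AE x in lebesgue_on U. continuous_on {0..T} (A x)) \<and>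
     (\<forall>t\<in>{0..T}. AE x in lebesgue_on U. transpose (A x t) = A x t \<and>
        (\<forall>y. \<kappa>0 * (norm y)\<^sup>2 \<le> y \<bullet> (A x t *v y) \<and> y \<bullet> (A x t *v y) \<le> \<kappa>1 * (norm y)\<^sup>2)) \<and>
     (\<exists>D. time_derivs U T A D \<and>
        (\<forall>k\<le>3. \<forall>t\<in>{0<..T}. \<forall>i j. W1inf_le U C (\<lambda>x. D k x t $ i $ j)))"

definition bounded_coeff ::
    "'a::euclidean_space set \<Rightarrow> real \<Rightarrow> real \<Rightarrow> ('a \<Rightarrow> real \<Rightarrow> 'b::euclidean_space) \<Rightarrow> bool" where
  "bounded_coeff U T C F \<longleftrightarrow>
     (\<lambda>(x, t). F x t) \<in> borel_measurable (lebesgue_on (U \<times> {0<..T})) \<and>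
     (\<exists>D. time_derivs U T F D \<and>
        (\<forall>k\<le>3. \<forall>t\<in>{0<..T}. Linf_norm (lebesgue_on U) (\<lambda>x. D k x t) \<le> ereal C))"

definition int_op ::
    "'a::euclidean_space set \<Rightarrow> ('a \<Rightarrow> 'a \<Rightarrow> real) \<Rightarrow> ('a \<Rightarrow> real) \<Rightarrow> 'a \<Rightarrow> real" where
  "int_op U g \<phi> x = (\<integral>y. \<phi> y * g x y \<partial>lebesgue_on U)"

definition bounded_int_op :: "'a::euclidean_space set \<Rightarrow> real \<Rightarrow> ('a \<Rightarrow> 'a \<Rightarrow> real) \<Rightarrow> bool" where
  "bounded_int_op U C g \<longleftrightarrow>
     (\<lambda>(x, y). g x y) \<in> borel_measurable (lebesgue_on (U \<times> U)) \<and>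
     (\<forall>\<phi>\<in>L2 U. (AE x in lebesgue_on U. integrable (lebesgue_on U) (\<lambda>y. \<phi> y * g x y)) \<and>
        int_op U g \<phi> \<in> L2 U \<and> l2norm U (int_op U g \<phi>) \<le> C * l2norm U \<phi>) \<and>
     (\<forall>\<phi>\<in>H1_0 U. int_op U g \<phi> \<in> sobolev 1 U \<and>
        sob_norm 1 U (int_op U g \<phi>) \<le> C * sob_norm 1 U \<phi>)"


section \<open>Mixed finite element spaces\<close>

definition inradius :: "'a::euclidean_space set \<Rightarrow> real" where
  "inradius K = Sup {r. \<exists>x. cball x r \<subseteq> K}"

definition simplicial_mesh :: "'a::euclidean_space set \<Rightarrow> real \<Rightarrow> 'a set set \<Rightarrow> bool" where
  "simplicial_mesh U h \<T> \<longleftrightarrow> triangulation \<T> \<and> (\<forall>K\<in>\<T>. int DIM('a) simplex K) \<and>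
     \<Union>\<T> = closure U \<and> h = Max (diameter ` \<T>)"

definition fin_dim_space :: "('a \<Rightarrow> 'b::real_vector) set \<Rightarrow> bool" where
  "fin_dim_space V \<longleftrightarrow>
     (\<exists>B. finite B \<and> V = {v. \<exists>a. v = (\<lambda>x. \<Sum>e\<in>B. a e *\<^sub>R e x)})"

definition piecewise_polynomial ::
    "'a::euclidean_space set set \<Rightarrow> ('a \<Rightarrow> 'b::euclidean_space) \<Rightarrow> bool" where
  "piecewise_polynomial \<T> v \<longleftrightarrow> (\<forall>K\<in>\<T>. \<exists>p. polynomial_function p \<and> ae_eq K v p)"

definition L2_proj :: "'a::euclidean_space set \<Rightarrow> ('a \<Rightarrow> real) set \<Rightarrow> ('a \<Rightarrow> real) \<Rightarrow> 'a \<Rightarrow> real" where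
  "L2_proj U V v = (SOME p. p \<in> V \<and> (\<forall>w\<in>V. l2ip U (\<lambda>x. v x - p x) w = 0))"

definition broken_H1_norm :: "'a::euclidean_space set set \<Rightarrow> ('a \<Rightarrow> real) \<Rightarrow> real" where
  "broken_H1_norm \<T> v = sqrt (\<Sum>K\<in>\<T>. (sob_norm 1 (interior K) v)\<^sup>2)"

definition fortin_projection :: "'a::euclidean_space set \<Rightarrow> ('a \<Rightarrow> real) set \<Rightarrow> ('a \<Rightarrow> 'a) set
    \<Rightarrow> (('a \<Rightarrow> 'a) \<Rightarrow> 'a \<Rightarrow> 'a) \<Rightarrow> bool" where
  "fortin_projection U V W Fh \<longleftrightarrow>
     (\<forall>w\<in>Hdiv U. Fh w \<in> W) \<and>
     (\<forall>w\<in>Hdiv U. \<forall>w'\<in>Hdiv U. ae_eq U w w' \<longrightarrow> ae_eq U (Fh w) (Fh w')) \<and>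
     (\<forall>w\<in>Hdiv U. \<forall>w'\<in>Hdiv U. \<forall>a b.
        ae_eq U (Fh (\<lambda>x. a *\<^sub>R w x + b *\<^sub>R w' x)) (\<lambda>x. a *\<^sub>R Fh w x + b *\<^sub>R Fh w' x)) \<and>
     (\<forall>w\<in>W. ae_eq U (Fh w) w) \<and>
     (\<forall>w\<in>Hdiv U. ae_eq U (wdiv U (Fh w)) (L2_proj U V (wdiv U w)))"

text \<open>A family of mixed finite element spaces, indexed by the mesh sizes in \<^term>\<open>H\<close>.

  The norm \<open>\<parallel>v - P\<^sub>h v\<parallel>\<^sub>1\<close> is taken elementwise, since mixed finite element spaces are in general
  discontinuous across element faces. The estimate for the Fortin projection is required for the
  fluxes \<open>w = A(t)\<nabla>\<phi>\<close> only: its right-hand side vanishes for divergence-free \<open>w\<close>, so that for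
  arbitrary \<open>w\<close> it would force every divergence-free field into the finite-dimensional \<open>W\<^sub>h\<close>.\<close>

definition mixed_fe_family :: "(real^'n::finite) set \<Rightarrow> real \<Rightarrow> (real^'n \<Rightarrow> real \<Rightarrow> real^'n^'n)
    \<Rightarrow> real set \<Rightarrow> (real \<Rightarrow> (real^'n) set set)
    \<Rightarrow> (real \<Rightarrow> (real^'n \<Rightarrow> real) set) \<Rightarrow> (real \<Rightarrow> (real^'n \<Rightarrow> real^'n) set) \<Rightarrow> bool" where
  "mixed_fe_family U T A H \<T> V W \<longleftrightarrow>
     (\<forall>h\<in>H. simplicial_mesh U h (\<T> h)) \<and>
     (\<exists>\<rho>>0. \<forall>h\<in>H. \<forall>K\<in>\<T> h. diameter K \<le> \<rho> * inradius K) \<and>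
     (\<forall>h\<in>H. fin_dim_space (V h) \<and> V h \<subseteq> L2 U \<and> (\<forall>v\<in>V h. piecewise_polynomial (\<T> h) v)) \<and>
     (\<forall>h\<in>H. fin_dim_space (W h) \<and> W h \<subseteq> Hdiv U \<and> (\<forall>w\<in>W h. piecewise_polynomial (\<T> h) w)) \<and>
     (\<forall>h\<in>H. \<forall>w\<in>W h. \<exists>v\<in>V h. ae_eq U (wdiv U w) v) \<and>
     (\<exists>Fh C. \<forall>h\<in>H. fortin_projection U (V h) (W h) (Fh h) \<and>
        (\<forall>r\<in>{1, 2}.
          (\<forall>w\<in>Hdiv U. (\<exists>\<phi>\<in>H1_0 U \<inter> sobolev 2 U. \<exists>t\<in>{0..T}. ae_eq U w (\<lambda>x. A x t *v wgrad U \<phi> x)) \<and>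
             wdiv U w \<in> sobolev (r - 1) U \<longrightarrow>
             l2norm U (\<lambda>x. w x - Fh h w x) \<le> C * h ^ r * sob_norm (r - 1) U (wdiv U w)) \<and>
          (\<forall>v\<in>sobolev r U.
             l2norm U (\<lambda>x. v x - L2_proj U (V h) v x)
               + h * broken_H1_norm (\<T> h) (\<lambda>x. v x - L2_proj U (V h) v x)
             \<le> C * h ^ r * sob_norm r U v)))"


section \<open>Time mesh, discrete Caputo derivative and kernels\<close>

definition graded_mesh :: "nat \<Rightarrow> real \<Rightarrow> real \<Rightarrow> nat \<Rightarrow> real" where
  "graded_mesh N \<gamma> T n = (real n / real N) powr \<gamma> * T"

definition step :: "(nat \<Rightarrow> real) \<Rightarrow> nat \<Rightarrow> real" where
  "step t n = t n - t (n - 1)"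

definition step_ratio :: "(nat \<Rightarrow> real) \<Rightarrow> nat \<Rightarrow> real" where
  "step_ratio t n = step t n / step t (n - 1)"

definition frac_kernel :: "real \<Rightarrow> real \<Rightarrow> real" where
  "frac_kernel \<beta> s = s powr (\<beta> - 1) / Gamma \<beta>"

definition L1_kernel :: "real \<Rightarrow> (nat \<Rightarrow> real) \<Rightarrow> nat \<Rightarrow> nat \<Rightarrow> real" where
  "L1_kernel \<alpha> t n j =
     1 / step t j * integral {t (j - 1)..t j} (\<lambda>s. frac_kernel (1 - \<alpha>) (t n - s))"

definition L1_deriv :: "real \<Rightarrow> (nat \<Rightarrow> real) \<Rightarrow> nat \<Rightarrow> (nat \<Rightarrow> real) \<Rightarrow> real" where
  "L1_deriv \<alpha> t n \<phi> = (\<Sum>j=1..n. L1_kernel \<alpha> t n j * (\<phi> j - \<phi> (j - 1)))"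

text \<open>Only the values for \<open>1 \<le> i \<le> n\<close> are meaningful.\<close>

function P_kernel :: "real \<Rightarrow> (nat \<Rightarrow> real) \<Rightarrow> nat \<Rightarrow> nat \<Rightarrow> real" where
  "P_kernel \<alpha> t n i =
     (if i < n
      then 1 / L1_kernel \<alpha> t i i *
           (\<Sum>j=i+1..n. P_kernel \<alpha> t n j * (L1_kernel \<alpha> t j (i + 1) - L1_kernel \<alpha> t j i))
      else 1 / L1_kernel \<alpha> t n n)"
  by pat_completeness auto
termination
  by (relation "Wellfounded.measure (\<lambda>(\<alpha>, t, n, i). n - i)") auto

declare P_kernel.simps [simp del]

definition n_start :: "real \<Rightarrow> nat \<Rightarrow> nat" where
  "n_start \<alpha> N = min (nat \<lfloor>1 / \<alpha>\<rfloor>) N"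

text \<open>The extrapolation operator \<open>E\<close>; \<^term>\<open>m\<close> is the number of initial steps with constant
  extrapolation.\<close>

definition extrapol :: "(nat \<Rightarrow> real) \<Rightarrow> nat \<Rightarrow> nat \<Rightarrow> (nat \<Rightarrow> real) \<Rightarrow> real" where
  "extrapol t m n \<phi> =
     (if n \<le> m then \<phi> (n - 1)
      else (1 + step_ratio t n) * \<phi> (n - 1) - step_ratio t n * \<phi> (n - 2))"

definition mittag_leffler :: "real \<Rightarrow> real \<Rightarrow> real" where
  "mittag_leffler \<alpha> z = (\<Sum>j. z ^ j / Gamma (real j * \<alpha> + 1))"


section \<open>The fully discrete scheme\<close>

definition imex_L1_mixed_fem :: "(real^'n::finite) set \<Rightarrow> real \<Rightarrow> (nat \<Rightarrow> real) \<Rightarrow> nat \<Rightarrow>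
    (real^'n \<Rightarrow> real \<Rightarrow> real^'n^'n) \<Rightarrow> (real^'n \<Rightarrow> real \<Rightarrow> real^'n) \<Rightarrow> (real^'n \<Rightarrow> real \<Rightarrow> real) \<Rightarrow>
    real \<Rightarrow> (real^'n \<Rightarrow> real^'n \<Rightarrow> real) \<Rightarrow> (real^'n \<Rightarrow> real \<Rightarrow> real) \<Rightarrow> (real^'n \<Rightarrow> real) \<Rightarrow>
    (real^'n \<Rightarrow> real) set \<Rightarrow> (real^'n \<Rightarrow> real^'n) set \<Rightarrow>
    (nat \<Rightarrow> real^'n \<Rightarrow> real) \<Rightarrow> (nat \<Rightarrow> real^'n \<Rightarrow> real^'n) \<Rightarrow> bool" where
  "imex_L1_mixed_fem U \<alpha> t N A b c lam g f u0 V W u \<sigma> \<longleftrightarrow>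
     (\<forall>n\<le>N. u n \<in> V \<and> \<sigma> n \<in> W) \<and>
     ae_eq U (u 0) (L2_proj U V u0) \<and>
     (\<forall>n\<le>N. \<forall>w\<in>W.
        l2ip U (\<lambda>x. matrix_inv (A x (t n)) *v \<sigma> n x) w + l2ip U (u n) (wdiv U w) = 0) \<and>
     (\<forall>n\<in>{1..N}. \<forall>v\<in>V.
        l2ip U (\<lambda>x. L1_deriv \<alpha> t n (\<lambda>j. u j x)) v
        - l2ip U (wdiv U (\<sigma> n)) v
        + l2ip U (\<lambda>x. b x (t n) \<bullet> (matrix_inv (A x (t n)) *v \<sigma> n x)) v
        + l2ip U (\<lambda>x. c x (t n) * u n x) v
        = lam * l2ip U (int_op U g (\<lambda>x. extrapol t (n_start \<alpha> N) n (\<lambda>j. u j x))) v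
          + l2ip U (\<lambda>x. extrapol t (n_start \<alpha> N) n (\<lambda>j. f x (t j))) v)"


section \<open>Stability constants\<close>

definition lambda_S :: "(real^'n::finite) set \<Rightarrow> real \<Rightarrow> (real^'n \<Rightarrow> real \<Rightarrow> real^'n^'n) \<Rightarrow>
    (real^'n \<Rightarrow> real \<Rightarrow> real^'n) \<Rightarrow> (real^'n \<Rightarrow> real \<Rightarrow> real) \<Rightarrow> real \<Rightarrow> real \<Rightarrow> real" where
  "lambda_S U T A b c \<epsilon> lam =
     1 / 2 * real_of_ereal (Linf_norm (lebesgue_on (U \<times> {0<..T}))
               (\<lambda>(x, t). b x t \<bullet> (matrix_inv (A x t) *v b x t)))
     + 2 * real_of_ereal (Linf_norm (lebesgue_on (U \<times> {0<..T})) (\<lambda>(x, t). max 0 (- c x t)))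
     + \<epsilon> * \<bar>lam\<bar>"

definition Lambda_S :: "real \<Rightarrow> real \<Rightarrow> real \<Rightarrow> real \<Rightarrow> real \<Rightarrow> real" where
  "Lambda_S lamS \<epsilon> lam CI \<mu> = lamS + 2 / \<epsilon> * \<bar>lam\<bar> * CI\<^sup>2 * ((1 + \<mu>)\<^sup>2 + \<mu>\<^sup>2)"

definition Lambda_seq :: "real \<Rightarrow> (nat \<Rightarrow> real) \<Rightarrow> nat \<Rightarrow> real \<Rightarrow> nat \<Rightarrow> real" where
  "Lambda_seq \<alpha> t m Lam n =
     (if n \<le> m then Lam
      else Lam * (1 + Max ((\<lambda>j. P_kernel \<alpha> t j j / P_kernel \<alpha> t j (j - 1)) ` {m + 1..n})))"

end

theory Submission
  imports Defs
begin

text \<open>The proof is an energy argument followed by a discrete fractional Gronwall inequality.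

Testing the scheme with \<open>v = u\<^sub>n\<close> and \<open>w = \<sigma>\<^sub>n\<close> eliminates the divergence terms. The convection term is
absorbed into \<open>(A\<^sup>-\<^sup>1\<sigma>, \<sigma>)\<close> by completing a square in the energy of \<open>A\<close>, at the price of
\<open>b\<^sup>T A\<^sup>-\<^sup>1 b / 4\<close>; the nonlocal term is split by Young's inequality with weight \<open>\<epsilon>\<close>. Since the weights
of the discrete Caputo derivative \<open>D\<close> increase in \<open>j\<close>, also \<open>D(\<parallel>u\<parallel>\<^sup>2) \<le> 2 (D u, u)\<close>, and so the norms
\<open>v\<^sub>n = \<parallel>u\<^sub>n\<parallel>\<close> satisfy (\<open>imex_energy_inequality\<close>, \<open>l2norm_extrapol_sq\<close>)
\<open>D(v\<^sup>2)\<^sub>n \<le> \<lambda> v\<^sub>n\<^sup>2 + a v\<^sub>n\<^sub>-\<^sub>1\<^sup>2 + b v\<^sub>n\<^sub>-\<^sub>2\<^sup>2 + 2 \<parallel>Ef\<^sub>n\<parallel> v\<^sub>n\<close>, where \<open>\<lambda>\<close> is the constant of the time-step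
restriction and \<open>\<lambda> + a + b = \<Lambda>\<close>.

The kernels \<open>P\<close> are the discrete convolution inverse of \<open>D\<close> (\<open>P_complementary\<close>, \<open>sum_P_D\<close>), so summing
against them bounds \<open>v\<^sub>n\<^sup>2\<close>. The time-step restriction says \<open>\<lambda> P\<^sub>n\<^sub>n \<le> 1/\<delta>\<close>, so that the implicit term can
be moved to the left at the cost of the factor \<open>\<delta>/(\<delta>-1)\<close>. What remains is a Volterra-type recursion,
which is iterated as in the Picard construction of the Mittag-Leffler function: one application of
\<open>P\<close> maps \<open>t\<^sup>k\<^sup>\<alpha> / \<Gamma>(k\<alpha>+1)\<close> below \<open>t\<^sup>(\<^sup>k\<^sup>+\<^sup>1\<^sup>)\<^sup>\<alpha> / \<Gamma>((k+1)\<alpha>+1)\<close>. This is a comparison of the exact with the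
discrete Caputo derivative of a power. For a concave power (\<open>(k+1)\<alpha> \<le> 1\<close>) the discrete derivative is
the larger one, by Chebyshev's integral inequality, and all summands \<open>j \<le> n\<close> are covered
(\<open>sum_P_ml_term_concave\<close>). For a convex power the comparison holds only after a shift by one mesh
point, which loses the summand \<open>j = n\<close> (\<open>sum_P_ml_term\<close>).

The lagged terms \<open>v\<^sub>j\<^sub>-\<^sub>1, v\<^sub>j\<^sub>-\<^sub>2\<close> do occur in that last summand. Up to the index \<open>1/\<alpha>\<close> only concave powers
are met in the iteration. Beyond it the last summand is charged to its neighbour, which costs the
factor \<open>1 + P\<^sub>n\<^sub>n / P\<^sub>n\<^sub>,\<^sub>n\<^sub>-\<^sub>1\<close>: this is the origin of the two cases in the definition of \<open>\<Lambda>\<^sub>n\<close>. On a graded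
mesh the step ratios decrease, so these factors are bounded, \<open>\<Lambda>\<^sub>n\<close> increases to its limit and the limit
can be used for all \<open>n\<close> (\<open>Lambda_seq_le_lim\<close>).

The functional-analytic part is to pass from the essential suprema over the space-time cylinder to
the single times \<open>t\<^sub>n\<close> (\<open>Linf_time_slice\<close>): a time slice is a null set, but the coefficients are
continuous in time for almost every \<open>x\<close>.\<close>

section \<open>Fractional kernels\<close>

lemma Gamma_plus1_pos: "(0::real) < x \<Longrightarrow> Gamma (x + 1) = x * Gamma x"
  by (rule Gamma_plus1) (auto elim!: nonpos_Ints_cases)

lemma frac_kernel_primitive:
  assumes "0 < \<alpha>" "\<alpha> < 1" "s < \<tau>"
  shows "((\<lambda>s. - ((\<tau> - s) powr (1 - \<alpha>)) / Gamma (2 - \<alpha>)) has_real_derivative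
           frac_kernel (1 - \<alpha>) (\<tau> - s)) (at s)"
proof -
  have "Gamma (2 - \<alpha>) = (1 - \<alpha>) * Gamma (1 - \<alpha>)"
    using Gamma_plus1_pos[of "1 - \<alpha>"] assms by simp
  moreover have "Gamma (1 - \<alpha>) \<noteq> 0"
    using assms Gamma_real_pos[of "1 - \<alpha>"] by linarith
  ultimately have "(1 - \<alpha>) / Gamma (2 - \<alpha>) = 1 / Gamma (1 - \<alpha>)" "Gamma (2 - \<alpha>) \<noteq> 0"
    using assms by simp_all
  then show ?thesis
    unfolding frac_kernel_def using assms
    by (auto intro!: derivative_eq_intros simp: divide_simps)
qed

lemma frac_kernel_primitive_continuous:
  fixes \<alpha> :: real
  assumes "\<alpha> < 1"
  shows "continuous_on {a..\<tau>} (\<lambda>s. - ((\<tau> - s) powr (1 - \<alpha>)) / Gamma (2 - \<alpha>))"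
proof -
  have "Gamma (2 - \<alpha>) \<noteq> 0" using assms Gamma_real_pos[of "2 - \<alpha>"] by linarith
  then show ?thesis
    using assms
    by (intro continuous_on_divide continuous_on_minus continuous_on_powr' continuous_on_diff
        continuous_on_id continuous_on_const) auto
qed

lemma frac_kernel_has_integral:
  assumes "0 < \<alpha>" "\<alpha> < 1" "a \<le> b" "b \<le> \<tau>"
  shows "((\<lambda>s. frac_kernel (1 - \<alpha>) (\<tau> - s)) has_integral
           ((\<tau> - a) powr (1 - \<alpha>) - (\<tau> - b) powr (1 - \<alpha>)) / Gamma (2 - \<alpha>)) {a..b}"
proof -
  have "continuous_on {a..b} (\<lambda>s. - ((\<tau> - s) powr (1 - \<alpha>)) / Gamma (2 - \<alpha>))"
    by (rule continuous_on_subset[OF frac_kernel_primitive_continuous]) (use assms in auto)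
  from fundamental_theorem_of_calculus_interior[OF assms(3) this,
      of "\<lambda>s. frac_kernel (1 - \<alpha>) (\<tau> - s)"]
  show ?thesis
    using frac_kernel_primitive[OF assms(1,2)] assms
    by (auto simp: has_real_derivative_iff_has_vector_derivative diff_divide_distrib)
qed

text \<open>The mean value \<open>\<xi>\<close> lies strictly inside the interval although the kernel is singular at \<open>s = \<tau>\<close>, because
the primitive stays continuous there. All sign and monotonicity properties of the discrete kernel
are read off from this representation.\<close>

lemma frac_kernel_mean_value:
  assumes "0 < \<alpha>" "\<alpha> < 1" "a < b" "b \<le> \<tau>"
  shows "\<exists>\<xi>. a < \<xi> \<and> \<xi> < b \<and>
     integral {a..b} (\<lambda>s. frac_kernel (1 - \<alpha>) (\<tau> - s)) = (b - a) * frac_kernel (1 - \<alpha>) (\<tau> - \<xi>)"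
proof -
  let ?F = "\<lambda>s. - ((\<tau> - s) powr (1 - \<alpha>)) / Gamma (2 - \<alpha>)"
  have "continuous_on {a..b} ?F"
    by (rule continuous_on_subset[OF frac_kernel_primitive_continuous]) (use assms in auto)
  moreover have "(?F has_derivative (*) (frac_kernel (1 - \<alpha>) (\<tau> - s))) (at s)"
    if "a < s" "s < b" for s
    using frac_kernel_primitive[OF assms(1,2), of s \<tau>] that assms
    by (simp add: has_field_derivative_def)
  ultimately obtain \<xi> where "a < \<xi>" "\<xi> < b"
    "?F b - ?F a = frac_kernel (1 - \<alpha>) (\<tau> - \<xi>) * (b - a)"
    using mvt[OF assms(3), of ?F "\<lambda>s. (*) (frac_kernel (1 - \<alpha>) (\<tau> - s))"] by blast
  moreover have "integral {a..b} (\<lambda>s. frac_kernel (1 - \<alpha>) (\<tau> - s)) = ?F b - ?F a"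
    using integral_unique[OF frac_kernel_has_integral[of \<alpha> a b \<tau>]] assms
    by (auto simp: diff_divide_distrib)
  ultimately show ?thesis by (auto simp: mult.commute)
qed

lemma frac_kernel_pos: "\<beta> > 0 \<Longrightarrow> s > 0 \<Longrightarrow> frac_kernel \<beta> s > 0"
  unfolding frac_kernel_def by simp

lemma frac_kernel_nonneg: "\<beta> > 0 \<Longrightarrow> frac_kernel \<beta> s \<ge> 0"
  unfolding frac_kernel_def by simp

lemma frac_kernel_strict_antimono:
  assumes "0 < \<beta>" "\<beta> < 1" "0 < r" "r < s"
  shows "frac_kernel \<beta> s < frac_kernel \<beta> r"
  unfolding frac_kernel_def using assms
  by (intro divide_strict_right_mono powr_less_mono2_neg) auto

lemma frac_kernel_antimono:
  assumes "0 < \<beta>" "\<beta> \<le> 1" "0 < r" "r \<le> s"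
  shows "frac_kernel \<beta> s \<le> frac_kernel \<beta> r"
  unfolding frac_kernel_def using assms
  by (intro divide_right_mono powr_mono2') auto

lemma frac_kernel_mono:
  assumes "1 \<le> \<beta>" "0 \<le> r" "r \<le> s"
  shows "frac_kernel \<beta> r \<le> frac_kernel \<beta> s"
  unfolding frac_kernel_def using assms
  by (intro divide_right_mono powr_mono2) auto

text \<open>The semigroup law of fractional integration, which is Euler's Beta integral scaled to \<open>[0, \<tau>]\<close>.\<close>

lemma frac_kernel_convolution:
  assumes "0 < \<alpha>" "\<alpha> < 1" "0 < \<beta>" "0 < \<tau>"
  shows "((\<lambda>s. frac_kernel (1 - \<alpha>) (\<tau> - s) * frac_kernel \<beta> s) has_integral
           frac_kernel (1 - \<alpha> + \<beta>) \<tau>) {0..\<tau>}"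
proof -
  \<comment> \<open>The Beta integral, then its substitution \<open>s \<mapsto> s / \<tau>\<close>.\<close>
  have "((\<lambda>s. s powr (\<beta> - 1) * (1 - s) powr (1 - \<alpha> - 1)) has_integral Beta \<beta> (1 - \<alpha>)) {0..1}"
    using has_integral_Beta_real[of \<beta> "1-\<alpha>"] assms by simp
  then have "((\<lambda>s. (s / \<tau>) powr (\<beta> - 1) * (1 - s / \<tau>) powr (- \<alpha>)) has_integral Beta \<beta> (1 - \<alpha>) * \<tau>) {0..\<tau>}"
    using has_integral_affinity'[of "\<lambda>s. s powr (\<beta> - 1) * (1 - s) powr (- \<alpha>)"
          "Beta \<beta> (1 - \<alpha>)" 0 1 "1/\<tau>" 0] assms
    by (simp add: mult.commute)
  then have *: "((\<lambda>s. \<tau> powr (\<beta> - \<alpha> - 1) / (Gamma \<beta> * Gamma (1-\<alpha>)) *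
       ((s / \<tau>) powr (\<beta> - 1) * (1 - s / \<tau>) powr (- \<alpha>)))
      has_integral \<tau> powr (\<beta> - \<alpha> - 1) / (Gamma \<beta> * Gamma (1-\<alpha>)) * (Beta \<beta> (1 - \<alpha>) * \<tau>)) {0..\<tau>}"
    by (rule has_integral_mult_right)
  have G: "Gamma \<beta> \<noteq> 0" "Gamma (1 - \<alpha>) \<noteq> 0"
    using assms Gamma_real_pos[of \<beta>] Gamma_real_pos[of "1 - \<alpha>"] by linarith+
  have val: "\<tau> powr (\<beta> - \<alpha> - 1) / (Gamma \<beta> * Gamma (1-\<alpha>)) * (Beta \<beta> (1 - \<alpha>) * \<tau>) =
        frac_kernel (1 - \<alpha> + \<beta>) \<tau>"
    using G assms by (simp add: Beta_def frac_kernel_def powr_diff add_ac)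
  show ?thesis
  proof (rule has_integral_eq[OF _ *[unfolded val]])
    fix s assume "s \<in> {0..\<tau>}"
    then have s: "0 \<le> s" "s \<le> \<tau>" by auto
    have "1 - s / \<tau> = (\<tau> - s) / \<tau>" using assms by (simp add: field_simps)
    then have "(s / \<tau>) powr (\<beta> - 1) * (1 - s / \<tau>) powr (- \<alpha>)
        = s powr (\<beta>-1) * (\<tau> - s) powr (-\<alpha>) / (\<tau> powr (\<beta>-1) * \<tau> powr (-\<alpha>))"
      using s assms by (simp add: powr_divide)
    also have "\<tau> powr (\<beta>-1) * \<tau> powr (-\<alpha>) = \<tau> powr (\<beta> - \<alpha> - 1)"
      by (simp add: powr_add[symmetric] algebra_simps)
    finally show "\<tau> powr (\<beta> - \<alpha> - 1) / (Gamma \<beta> * Gamma (1-\<alpha>)) *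
       ((s / \<tau>) powr (\<beta> - 1) * (1 - s / \<tau>) powr (- \<alpha>)) =
       frac_kernel (1 - \<alpha>) (\<tau> - s) * frac_kernel \<beta> s"
      using assms by (simp add: frac_kernel_def mult.commute)
  qed
qed

lemma frac_power_has_integral:
  assumes "0 < \<beta>" "0 \<le> a" "a \<le> b"
  shows "(frac_kernel \<beta> has_integral (b powr \<beta> / Gamma (\<beta> + 1) - a powr \<beta> / Gamma (\<beta> + 1))) {a..b}"
proof -
  have c: "continuous_on {a..b} (\<lambda>s. s powr \<beta> / Gamma (\<beta> + 1))"
  proof -
    have "Gamma (\<beta> + 1) \<noteq> 0" using assms Gamma_real_pos[of "\<beta> + 1"] by linarith
    then show ?thesis
      using assms
      by (intro continuous_on_divide continuous_on_powr' continuous_on_id continuous_on_const) auto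
  qed
  have "Gamma (\<beta> + 1) = \<beta> * Gamma \<beta>"
    using Gamma_plus1_pos assms by simp
  moreover have "Gamma \<beta> \<noteq> 0" using assms Gamma_real_pos[of \<beta>] by linarith
  ultimately have "((\<lambda>s. s powr \<beta> / Gamma (\<beta> + 1)) has_vector_derivative frac_kernel \<beta> s) (at s)"
    if "s \<in> {a<..<b}" for s
    unfolding frac_kernel_def has_real_derivative_iff_has_vector_derivative[symmetric]
    using that assms by (auto intro!: derivative_eq_intros simp: field_simps)
  from fundamental_theorem_of_calculus_interior[OF assms(3) c this] show ?thesis by simp
qed

text \<open>The product of \<open>f - f \<xi>\<close> and \<open>g - g \<xi>\<close> is nowhere positive, and since \<open>f \<xi>\<close> is the mean of \<open>f\<close>, its integral
is the difference of the two sides. Monotonicity is only required in the open interval, so that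
both functions may be singular at the ends.\<close>

lemma Chebyshev_integral_opposite_monotone:
  fixes f g :: "real \<Rightarrow> real"
  assumes ab: "a < b" and \<xi>: "a < \<xi>" "\<xi> < b" "integral {a..b} f = (b - a) * f \<xi>"
    and mono: "\<And>r s. a < r \<Longrightarrow> r \<le> s \<Longrightarrow> s < b \<Longrightarrow> f r \<le> f s"
    and anti: "\<And>r s. a < r \<Longrightarrow> r \<le> s \<Longrightarrow> s < b \<Longrightarrow> g s \<le> g r"
    and int: "f integrable_on {a..b}" "g integrable_on {a..b}" "(\<lambda>s. f s * g s) integrable_on {a..b}"
  shows "integral {a..b} (\<lambda>s. f s * g s) \<le> f \<xi> * integral {a..b} g"
proof -
  let ?h = "\<lambda>s. (f s - f \<xi>) * (g s - g \<xi>)"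
  have h: "?h = (\<lambda>s. f s * g s - f \<xi> * g s - g \<xi> * f s + f \<xi> * g \<xi>)"
    by (auto simp: algebra_simps)
  have "(?h has_integral integral {a..b} (\<lambda>s. f s * g s) - f \<xi> * integral {a..b} g
      - g \<xi> * integral {a..b} f + f \<xi> * g \<xi> * (b - a)) {a..b}"
    unfolding h
    using has_integral_const_real[of "f \<xi> * g \<xi>" a b] ab
    by (intro has_integral_add has_integral_diff has_integral_mult_right integrable_integral int)
       (auto simp: mult.commute)
  then have "(?h has_integral integral {a..b} (\<lambda>s. f s * g s) - f \<xi> * integral {a..b} g) {a..b}"
    using \<xi>(3) by (simp add: algebra_simps)
  then have "(?h has_integral integral {a..b} (\<lambda>s. f s * g s) - f \<xi> * integral {a..b} g) {a<..<b}"
    using has_integral_open_interval[of ?h _ a b] by (simp add: box_real)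
  moreover have "?h s \<le> 0" if "s \<in> {a<..<b}" for s
  proof (cases "s \<le> \<xi>")
    case True then show ?thesis
      using mono[of s \<xi>] anti[of s \<xi>] that \<xi> by (auto intro: mult_nonpos_nonneg)
  next
    case False then show ?thesis
      using mono[of \<xi> s] anti[of \<xi> s] that \<xi> by (auto intro: mult_nonneg_nonpos)
  qed
  ultimately have "integral {a..b} (\<lambda>s. f s * g s) - f \<xi> * integral {a..b} g \<le> 0"
    by (rule has_integral_le[OF _ has_integral_0])
  then show ?thesis by simp
qed

section \<open>The discrete Caputo derivative and its complementary kernels\<close>

locale L1_mesh =
  fixes \<alpha> :: real and t :: "nat \<Rightarrow> real"
  assumes \<alpha>: "0 < \<alpha>" "\<alpha> < 1"
    and t_0: "t 0 = 0"
    and t_strict_mono: "strict_mono t"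
begin

abbreviation "K \<equiv> L1_kernel \<alpha> t"
abbreviation "P \<equiv> P_kernel \<alpha> t"
abbreviation "D \<equiv> L1_deriv \<alpha> t"

lemma t_less: "i < j \<Longrightarrow> t i < t j"
  using t_strict_mono by (rule strict_monoD)

lemma t_le: "i \<le> j \<Longrightarrow> t i \<le> t j"
  using t_strict_mono by (simp add: strict_mono_less_eq)

lemma t_nonneg: "0 \<le> t j"
  using t_le[of 0 j] t_0 by simp

lemma t_pos: "1 \<le> j \<Longrightarrow> 0 < t j"
  using t_less[of 0 j] t_0 by simp

lemma step_pos: "1 \<le> j \<Longrightarrow> 0 < step t j"
  unfolding step_def using t_less[of "j - 1" j] by simp

lemma K_mean_value:
  assumes "1 \<le> j" "j \<le> n"
  shows "\<exists>\<xi>. t (j - 1) < \<xi> \<and> \<xi> < t j \<and> K n j = frac_kernel (1 - \<alpha>) (t n - \<xi>)"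
proof -
  have "t (j - 1) < t j" "t j \<le> t n" using assms by (auto intro: t_less t_le)
  from frac_kernel_mean_value[OF \<alpha> this] obtain \<xi> where "t (j - 1) < \<xi>" "\<xi> < t j"
    "integral {t (j - 1)..t j} (\<lambda>s. frac_kernel (1 - \<alpha>) (t n - s))
       = (t j - t (j - 1)) * frac_kernel (1 - \<alpha>) (t n - \<xi>)" by blast
  then show ?thesis
    by (intro exI[of _ \<xi>]) (simp add: L1_kernel_def step_def)
qed

lemma K_pos:
  assumes "1 \<le> j" "j \<le> n"
  shows "0 < K n j"
proof -
  obtain \<xi> where "\<xi> < t j" "K n j = frac_kernel (1 - \<alpha>) (t n - \<xi>)"
    using K_mean_value[OF assms] by blast
  then show ?thesis using t_le[OF assms(2)] \<alpha> by (auto intro!: frac_kernel_pos)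
qed

lemma K_strict_mono:
  assumes "1 \<le> j" "j < n"
  shows "K n j < K n (Suc j)"
proof -
  obtain \<xi> where \<xi>: "\<xi> < t j" "K n j = frac_kernel (1 - \<alpha>) (t n - \<xi>)"
    using K_mean_value[of j n] assms by auto
  obtain \<eta> where \<eta>: "t j < \<eta>" "\<eta> < t (Suc j)" "K n (Suc j) = frac_kernel (1 - \<alpha>) (t n - \<eta>)"
    using K_mean_value[of "Suc j" n] assms by auto
  show ?thesis
    unfolding \<xi> \<eta> using \<xi> \<eta> \<alpha> t_le[of "Suc j" n] assms
    by (intro frac_kernel_strict_antimono) auto
qed

lemma K_has_integral:
  assumes "1 \<le> j" "j \<le> n"
  shows "((\<lambda>s. frac_kernel (1 - \<alpha>) (t n - s)) has_integral step t j * K n j) {t (j - 1)..t j}"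
proof -
  have "t (j - 1) \<le> t j" "t j \<le> t n" by (auto intro: t_le assms)
  from frac_kernel_has_integral[OF \<alpha> this] show ?thesis
    using step_pos[OF assms(1)] integral_unique by (fastforce simp: L1_kernel_def)
qed

lemma K_eq:
  assumes "1 \<le> j" "j \<le> n"
  shows "K n j = ((t n - t (j - 1)) powr (1 - \<alpha>) - (t n - t j) powr (1 - \<alpha>))
                   / (Gamma (2 - \<alpha>) * step t j)"
proof -
  have "t (j - 1) \<le> t j" "t j \<le> t n" by (auto intro: t_le assms)
  from integral_unique[OF frac_kernel_has_integral[OF \<alpha> this]] show ?thesis
    by (simp add: L1_kernel_def)
qed

lemma K_diag:
  assumes "1 \<le> n"
  shows "K n n = step t n powr (- \<alpha>) / Gamma (2 - \<alpha>)"
proof -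
  have "K n n = step t n powr (1 - \<alpha>) / (Gamma (2 - \<alpha>) * step t n)"
    using K_eq[of n n] assms by (simp add: step_def)
  also have "step t n powr (1 - \<alpha>) = step t n * step t n powr (- \<alpha>)"
    using step_pos[OF assms] by (simp add: powr_diff powr_minus field_simps)
  finally show ?thesis using step_pos[OF assms] by simp
qed

lemma P_diag: "P n n = 1 / K n n"
  by (simp add: P_kernel.simps)

lemma P_rec: "i < n \<Longrightarrow> P n i = 1 / K i i * (\<Sum>j=i+1..n. P n j * (K j (i + 1) - K j i))"
  by (subst P_kernel.simps) simp

lemma P_diag_eq: "1 \<le> n \<Longrightarrow> P n n = Gamma (2 - \<alpha>) * step t n powr \<alpha>"
  using step_pos[of n] by (simp add: P_diag K_diag powr_minus field_simps)

lemma P_nonneg: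
  assumes "1 \<le> i" "i \<le> n"
  shows "0 \<le> P n i"
  using assms(2,1)
proof (induction i rule: measure_induct_rule[of "\<lambda>i. n - i"])
  case (less i)
  show ?case
  proof (cases "i < n")
    case True
    have "0 \<le> P n j * (K j (i + 1) - K j i)" if "j \<in> {i+1..n}" for j
      using less.IH[of j] K_strict_mono[of i j] that True less.prems
      by (intro mult_nonneg_nonneg) auto
    then have "0 \<le> (\<Sum>j=i+1..n. P n j * (K j (i + 1) - K j i))"
      by (rule sum_nonneg)
    then show ?thesis
      using P_rec[OF True] K_pos[of i i] less.prems by simp
  next
    case False
    then show ?thesis using P_diag[of n] K_pos[of n n] less.prems by simp
  qed
qed

lemma P_diag_pos: "1 \<le> n \<Longrightarrow> 0 < P n n"
  using P_diag[of n] K_pos[of n n] by simp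

lemma P_subdiag:
  assumes "2 \<le> n"
  shows "P n (n - 1) = P n n * (K n n - K n (n - 1)) / K (n - 1) (n - 1)"
  using P_rec[of "n - 1" n] assms by simp

lemma P_subdiag_pos:
  assumes "2 \<le> n"
  shows "0 < P n (n - 1)"
  using P_subdiag[OF assms] P_diag_pos[of n] K_strict_mono[of "n - 1" n] K_pos[of "n - 1" "n - 1"] assms
  by simp

text \<open>The recursion defining \<open>P\<close> says exactly that this sum does not change when \<open>i\<close> is raised by one, which
reduces the claim to \<open>i = n\<close>.\<close>

lemma P_complementary:
  assumes "1 \<le> i" "i \<le> n"
  shows "(\<Sum>j=i..n. P n j * K j i) = 1"
  using assms(2,1)
proof (induction i rule: inc_induct)
  case base
  then show ?case using P_diag[of n] K_pos[of n n] by simp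
next
  case (step i)
  have "(\<Sum>j=i..n. P n j * K j i) = P n i * K i i + (\<Sum>j=Suc i..n. P n j * K j i)"
    using step.hyps by (simp add: sum.atLeast_Suc_atMost)
  also have "P n i * K i i = (\<Sum>j=Suc i..n. P n j * (K j (i + 1) - K j i))"
    using P_rec[of i n] K_pos[of i i] step by simp
  also have "\<dots> + (\<Sum>j=Suc i..n. P n j * K j i) = (\<Sum>j=Suc i..n. P n j * K j (Suc i))"
    by (simp add: sum.distrib[symmetric] algebra_simps)
  also have "\<dots> = 1" using step by simp
  finally show ?case .
qed

text \<open>\<open>P\<close> inverts the discrete Caputo derivative, as the fractional integral inverts the exact one.\<close>

lemma sum_P_D: "(\<Sum>j=1..n. P n j * D j \<phi>) = \<phi> n - \<phi> 0"
proof -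
  have "(\<Sum>j=1..n. P n j * D j \<phi>) =
      (\<Sum>j\<in>{1..n}. \<Sum>i | i \<in> {1..n} \<and> i \<le> j. P n j * K j i * (\<phi> i - \<phi> (i - 1)))"
    unfolding L1_deriv_def sum_distrib_left
    by (intro sum.cong) (auto simp: mult.assoc)
  also have "\<dots> = (\<Sum>i\<in>{1..n}. \<Sum>j | j \<in> {1..n} \<and> i \<le> j. P n j * K j i * (\<phi> i - \<phi> (i - 1)))"
    by (rule sum.swap_restrict) auto
  also have "\<dots> = (\<Sum>i\<in>{1..n}. \<phi> i - \<phi> (i - 1))"
  proof (rule sum.cong)
    fix i assume i: "i \<in> {1..n}"
    have "{j. j \<in> {1..n} \<and> i \<le> j} = {i..n}" using i by auto
    then show "(\<Sum>j | j \<in> {1..n} \<and> i \<le> j. P n j * K j i * (\<phi> i - \<phi> (i - 1))) = \<phi> i - \<phi> (i - 1)"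
      using P_complementary[of i n] i by (simp add: sum_distrib_right[symmetric])
  qed simp
  also have "\<dots> = \<phi> n - \<phi> 0"
    by (induction n) auto
  finally show ?thesis .
qed

section \<open>Discrete and exact fractional derivatives of powers\<close>

lemma integral_mesh:
  fixes F :: "real \<Rightarrow> real"
  assumes "F integrable_on {0..t n}"
  shows "integral {0..t n} F = (\<Sum>i=1..n. integral {t (i - 1)..t i} F)"
  using assms
proof (induction n)
  case 0
  then show ?case by (simp add: t_0)
next
  case (Suc n)
  have "F integrable_on {0..t n}"
    by (rule integrable_on_subinterval[OF Suc.prems]) (auto intro: t_le[of n "Suc n", THEN order_trans[rotated]])
  moreover have "integral {0..t n} F + integral {t n..t (Suc n)} F = integral {0..t (Suc n)} F"
    by (rule Henstock_Kurzweil_Integration.integral_combine) (use Suc t_nonneg t_le[of n "Suc n"] in auto)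
  ultimately show ?case using Suc by simp
qed

text \<open>The fractional integral of order \<open>\<beta>\<close> of the constant \<open>1\<close>, at the mesh points.\<close>

definition "mesh_power \<beta> i = t i powr \<beta> / Gamma (\<beta> + 1)"

lemma integral_frac_kernel_step:
  assumes "0 < \<beta>" "1 \<le> i"
  shows "(frac_kernel \<beta> has_integral (mesh_power \<beta> i - mesh_power \<beta> (i - 1))) {t (i - 1)..t i}"
  unfolding mesh_power_def using assms t_nonneg by (intro frac_power_has_integral t_le) auto

lemma convolution_split:
  assumes "0 < \<beta>" "1 \<le> j"
  shows "frac_kernel (1 - \<alpha> + \<beta>) (t j) =
     (\<Sum>i=1..j. integral {t (i - 1)..t i} (\<lambda>s. frac_kernel (1 - \<alpha>) (t j - s) * frac_kernel \<beta> s))"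
    and "1 \<le> i \<Longrightarrow> i \<le> j \<Longrightarrow>
     (\<lambda>s. frac_kernel (1 - \<alpha>) (t j - s) * frac_kernel \<beta> s) integrable_on {t (i - 1)..t i}"
proof -
  note * = frac_kernel_convolution[OF \<alpha> assms(1) t_pos[OF assms(2)]]
  show "frac_kernel (1 - \<alpha> + \<beta>) (t j) =
     (\<Sum>i=1..j. integral {t (i - 1)..t i} (\<lambda>s. frac_kernel (1 - \<alpha>) (t j - s) * frac_kernel \<beta> s))"
    using integral_mesh[OF has_integral_integrable[OF *]] integral_unique[OF *] by simp
  show "1 \<le> i \<Longrightarrow> i \<le> j \<Longrightarrow>
     (\<lambda>s. frac_kernel (1 - \<alpha>) (t j - s) * frac_kernel \<beta> s) integrable_on {t (i - 1)..t i}"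
    by (rule integrable_on_subinterval[OF has_integral_integrable[OF *]])
       (use t_nonneg t_le[of i j] in \<open>force intro: order_trans\<close>)
qed

text \<open>The left-hand side is the exact Caputo derivative of the power, a sum of integrals of the increasing
kernel against the decreasing derivative of a concave power. Replacing that derivative by its mean
over each interval gives the discrete derivative, and by Chebyshev's inequality it can only increase
the integrals.\<close>

lemma frac_power_le_D:
  assumes "0 < \<beta>" "\<beta> \<le> 1" "1 \<le> j"
  shows "frac_kernel (1 - \<alpha> + \<beta>) (t j) \<le> D j (mesh_power \<beta>)"
  unfolding convolution_split(1)[OF assms(1,3)] L1_deriv_def
proof (rule sum_mono)
  fix i assume "i \<in> {1..j}"
  then have i: "1 \<le> i" "i \<le> j" by auto
  have st: "t j - t (i - 1) > 0" "t i \<le> t j" "t (i - 1) < t i" "t (i - 1) \<ge> 0"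
    using t_less[of "i-1" j] t_le[of i j] t_less[of "i-1" i] t_nonneg i by auto
  obtain \<xi> where \<xi>: "t (i - 1) < \<xi>" "\<xi> < t i" "K j i = frac_kernel (1 - \<alpha>) (t j - \<xi>)"
    using K_mean_value[OF i] by blast
  let ?f = "\<lambda>s. frac_kernel (1 - \<alpha>) (t j - s)"
  note f = K_has_integral[OF i] and g = integral_frac_kernel_step[OF assms(1) i(1)]
  have "integral {t (i - 1)..t i} (\<lambda>s. ?f s * frac_kernel \<beta> s) \<le>
      ?f \<xi> * integral {t (i - 1)..t i} (frac_kernel \<beta>)"
  proof (rule Chebyshev_integral_opposite_monotone[OF st(3) \<xi>(1,2)])
    show "integral {t (i - 1)..t i} ?f = (t i - t (i - 1)) * ?f \<xi>"
      using integral_unique[OF f] \<xi>(3) by (simp add: step_def)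
  qed (use f g convolution_split(2)[OF assms(1,3) i] has_integral_integrable st \<alpha> assms
       in \<open>auto intro!: frac_kernel_antimono\<close>)
  then show "integral {t (i - 1)..t i} (\<lambda>s. ?f s * frac_kernel \<beta> s) \<le> K j i * (mesh_power \<beta> i - mesh_power \<beta> (i - 1))"
    using integral_unique[OF g] \<xi>(3) by simp
qed

text \<open>For a convex power Chebyshev's inequality points in the wrong direction. Instead the derivative is
bounded on each interval by its value at the right end, and this value by the mean over the next
interval; passing from one interval to the next needs nondecreasing steps.\<close>

lemma frac_power_le_shifted_D:
  assumes "1 \<le> \<beta>" "1 \<le> j" and steps: "\<And>i. 1 \<le> i \<Longrightarrow> step t i \<le> step t (Suc i)"
  shows "frac_kernel (1 - \<alpha> + \<beta>) (t j) \<le> D j (\<lambda>i. mesh_power \<beta> (Suc i))"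
proof -
  have b0: "0 < \<beta>" using assms by simp
  show ?thesis
  unfolding convolution_split(1)[OF b0 assms(2)] L1_deriv_def
  proof (rule sum_mono)
    fix i assume "i \<in> {1..j}"
    then have i: "1 \<le> i" "i \<le> j" by auto
    let ?f = "\<lambda>s. frac_kernel (1 - \<alpha>) (t j - s)"
    let ?c = "frac_kernel \<beta> (t i)"
    have st: "0 \<le> t (i - 1)" "t (i-1) \<le> t i" "t i \<le> t (Suc i)" by (auto intro: t_nonneg t_le)
    have c0: "?c \<ge> 0" using b0 by (rule frac_kernel_nonneg)
    have int: "((\<lambda>s. ?f s * ?c) has_integral step t i * K j i * ?c) {t (i - 1)..t i}"
      by (rule has_integral_mult_left[OF K_has_integral[OF i]])
    have "integral {t (i - 1)..t i} (\<lambda>s. ?f s * frac_kernel \<beta> s) \<le> step t i * K j i * ?c"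
      using st \<alpha> assms
      by (intro has_integral_le[OF integrable_integral[OF convolution_split(2)[OF b0 assms(2) i]] int]
            mult_left_mono frac_kernel_mono frac_kernel_nonneg) auto
    also have "\<dots> = K j i * (step t i * ?c)" by simp
    also have "step t i * ?c \<le> step t (Suc i) * ?c"
      using steps[OF i(1)] c0 by (rule mult_right_mono)
    also have "step t (Suc i) * ?c \<le> mesh_power \<beta> (Suc i) - mesh_power \<beta> i"
    proof -
      have "((\<lambda>_. ?c) has_integral (t (Suc i) - t i) * ?c) {t i..t (Suc i)}"
        using has_integral_const_real[of ?c "t i" "t (Suc i)"] st by simp
      moreover have "(frac_kernel \<beta> has_integral (mesh_power \<beta> (Suc i) - mesh_power \<beta> i)) {t i..t (Suc i)}"
        using integral_frac_kernel_step[OF b0, of "Suc i"] by simp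
      ultimately have "(t (Suc i) - t i) * ?c \<le> mesh_power \<beta> (Suc i) - mesh_power \<beta> i"
        by (rule has_integral_le) (use assms st t_nonneg in \<open>auto intro!: frac_kernel_mono\<close>)
      then show ?thesis by (simp add: step_def)
    qed
    finally show "integral {t (i - 1)..t i} (\<lambda>s. ?f s * frac_kernel \<beta> s) \<le>
        K j i * (mesh_power \<beta> (Suc i) - mesh_power \<beta> (Suc (i - 1)))"
      using K_pos[OF i] i by (simp add: mult_left_mono)
  qed
qed

lemma sum_P_frac_power_concave:
  assumes "0 < \<beta>" "\<beta> \<le> 1"
  shows "(\<Sum>j=1..n. P n j * frac_kernel (1 - \<alpha> + \<beta>) (t j)) \<le> mesh_power \<beta> n"
proof -
  have "(\<Sum>j=1..n. P n j * frac_kernel (1 - \<alpha> + \<beta>) (t j)) \<le> (\<Sum>j=1..n. P n j * D j (mesh_power \<beta>))"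
    by (intro sum_mono mult_left_mono frac_power_le_D P_nonneg assms) auto
  also have "\<dots> = mesh_power \<beta> n" unfolding sum_P_D using assms by (simp add: mesh_power_def t_0)
  finally show ?thesis .
qed

lemma mesh_power_mono: "0 < \<beta> \<Longrightarrow> i \<le> j \<Longrightarrow> mesh_power \<beta> i \<le> mesh_power \<beta> j"
  unfolding mesh_power_def using t_nonneg t_le by (intro divide_right_mono powr_mono2) auto

text \<open>The discrete derivative of the shifted power is summed over \<open>j < n\<close> only. The summand \<open>j = n\<close>, which is
left out, is at least the last increment \<open>t\<^sub>n\<^sub>+\<^sub>1\<^sup>\<beta> - t\<^sub>n\<^sup>\<beta>\<close> of the telescoping sum (up to the Gamma
factor), so that the result does not involve \<open>t\<^sub>n\<^sub>+\<^sub>1\<close>.\<close>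

lemma sum_P_frac_power_convex:
  assumes "1 \<le> \<beta>" "1 \<le> n" and steps: "\<And>i. 1 \<le> i \<Longrightarrow> step t i \<le> step t (Suc i)"
  shows "(\<Sum>j=1..n-1. P n j * frac_kernel (1 - \<alpha> + \<beta>) (t j)) \<le> mesh_power \<beta> n"
proof -
  let ?\<phi> = "\<lambda>i. mesh_power \<beta> (Suc i)"
  have "(\<Sum>j=1..n-1. P n j * frac_kernel (1 - \<alpha> + \<beta>) (t j)) \<le> (\<Sum>j=1..n-1. P n j * D j ?\<phi>)"
    by (intro sum_mono mult_left_mono frac_power_le_shifted_D P_nonneg assms) auto
  also have "\<dots> = (\<Sum>j=1..n. P n j * D j ?\<phi>) - P n n * D n ?\<phi>"
    using assms(2) by (cases n) auto
  also have "(\<Sum>j=1..n. P n j * D j ?\<phi>) = mesh_power \<beta> (Suc n) - mesh_power \<beta> 1"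
    unfolding sum_P_D by simp
  also have "mesh_power \<beta> (Suc n) - mesh_power \<beta> 1 - P n n * D n ?\<phi> \<le> mesh_power \<beta> n - mesh_power \<beta> 1"
  proof -
    have "K n n * (?\<phi> n - ?\<phi> (n - 1)) \<le> D n ?\<phi>"
      unfolding L1_deriv_def
      by (rule member_le_sum)
         (use assms K_pos in \<open>auto intro!: mult_nonneg_nonneg mesh_power_mono less_imp_le[OF K_pos]\<close>)
    then have "P n n * (K n n * (?\<phi> n - ?\<phi> (n - 1))) \<le> P n n * D n ?\<phi>"
      using P_diag_pos[OF assms(2)] by (intro mult_left_mono) auto
    moreover have "P n n * (K n n * (?\<phi> n - ?\<phi> (n - 1))) = mesh_power \<beta> (Suc n) - mesh_power \<beta> n"
      using P_diag[of n] K_pos[of n n] assms(2) by simp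
    ultimately show ?thesis by simp
  qed
  also have "\<dots> \<le> mesh_power \<beta> n" using assms by (simp add: mesh_power_def)
  finally show ?thesis .
qed

end

section \<open>The Mittag-Leffler series\<close>

text \<open>Restrict Euler's integral to \<open>[R, \<infinity>)\<close> and bound the power there by its value at \<open>R\<close>. The freedom
in \<open>R\<close> shows that \<open>\<Gamma>\<close> grows faster than every exponential.\<close>

lemma Gamma_lower_bound:
  fixes x R :: real
  assumes "0 \<le> x" "0 \<le> R"
  shows "R powr x * exp (- R) \<le> Gamma (x + 1)"
proof -
  have g: "((\<lambda>s. s powr x / exp s) has_integral Gamma (x + 1)) {0..}"
    using Gamma_integral_real[of "x + 1"] assms by simp
  have "((\<lambda>s. R powr x * exp (- s)) has_integral R powr x * exp (- R)) {R..}"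
    using has_integral_mult_right[OF has_integral_exp_minus_to_infinity[of 1 R], of "R powr x"] by simp
  then have f: "((\<lambda>s. if s \<in> {R..} then R powr x * exp (- s) else 0)
       has_integral R powr x * exp (- R)) {0..}"
    by (subst has_integral_restrict) (use assms in auto)
  show ?thesis
    by (rule has_integral_le[OF f g])
       (use assms in \<open>auto simp: exp_minus field_simps intro!: powr_mono2\<close>)
qed

lemma mittag_leffler_summable:
  fixes z :: real
  assumes "0 < \<alpha>" "0 \<le> z"
  shows "summable (\<lambda>j. z ^ j / Gamma (real j * \<alpha> + 1))"
proof -
  \<comment> \<open>Chosen such that \<open>R\<^sup>j\<^sup>\<alpha>\<close> beats \<open>z\<^sup>j\<close> by the factor \<open>2\<^sup>j\<close>; adding \<open>1\<close> covers \<open>z = 0\<close>.\<close>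
  define R where "R = (2 * (z + 1)) powr (1 / \<alpha>)"
  have R: "R powr (real j * \<alpha>) = (2 * (z + 1)) ^ j" for j
    using assms by (simp add: R_def powr_powr powr_realpow)
  show ?thesis
  proof (rule summable_comparison_test'[of "\<lambda>j. exp R * (1/2) ^ j" 0])
    fix j :: nat
    have G: "(2 * (z + 1)) ^ j * exp (- R) \<le> Gamma (real j * \<alpha> + 1)"
      using Gamma_lower_bound[of "real j * \<alpha>" R] R assms by (simp add: R_def)
    have pos: "0 < (2 * (z + 1)) ^ j * exp (- R)" using assms by simp
    have "z ^ j / Gamma (real j * \<alpha> + 1) \<le> (z + 1) ^ j / ((2 * (z + 1)) ^ j * exp (- R))"
      using G pos assms by (intro frac_le power_mono) auto
    also have "\<dots> = exp R * (1/2) ^ j"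
      using assms unfolding power_mult_distrib by (simp add: exp_minus field_simps)
    finally show "norm (z ^ j / Gamma (real j * \<alpha> + 1)) \<le> exp R * (1/2) ^ j"
      using order.strict_trans2[OF pos G] assms by simp
  qed (auto intro!: summable_mult summable_geometric)
qed

lemma mittag_leffler_ge_partial_sum:
  assumes "0 < \<alpha>" "0 \<le> z"
  shows "(\<Sum>k\<le>n. z ^ k / Gamma (real k * \<alpha> + 1)) \<le> mittag_leffler \<alpha> z"
  unfolding mittag_leffler_def
  by (rule sum_le_suminf[OF mittag_leffler_summable[OF assms]])
     (use assms in \<open>auto intro!: divide_nonneg_pos Gamma_real_pos add_nonneg_pos\<close>)

section \<open>A discrete fractional Gronwall inequality\<close>

context L1_mesh
begin

text \<open>The summands of \<open>E\<^sub>\<alpha>(t\<^sub>j\<^sup>\<alpha>)\<close>. Up to the Gamma factor they are the powers \<open>t\<^sub>j\<^sup>k\<^sup>\<alpha>\<close>, except that the summand \<open>k = 0\<close> has to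
be \<open>1\<close> also at \<open>t\<^sub>0 = 0\<close>, where a real power of base zero would vanish.\<close>

definition "ml_term k j = (t j powr \<alpha>) ^ k / Gamma (real k * \<alpha> + 1)"

lemma ml_term_nonneg: "0 \<le> ml_term k j"
  unfolding ml_term_def using \<alpha> by (intro divide_nonneg_pos Gamma_real_pos add_nonneg_pos) auto

lemma ml_term_mono: "i \<le> j \<Longrightarrow> ml_term k i \<le> ml_term k j"
  unfolding ml_term_def using \<alpha> t_nonneg t_le
  by (intro divide_right_mono power_mono powr_mono2)
     (auto intro!: less_imp_le[OF Gamma_real_pos] add_nonneg_pos)

lemma ml_term_Suc: "ml_term (Suc k) j = mesh_power (real (Suc k) * \<alpha>) j"
  unfolding ml_term_def mesh_power_def using \<alpha>
  by (cases "t j = 0") (auto simp: powr_power simp del: power_Suc)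

lemma ml_term_frac_kernel:
  assumes "1 \<le> j"
  shows "frac_kernel (1 - \<alpha> + real (Suc k) * \<alpha>) (t j) = ml_term k j"
  unfolding ml_term_def frac_kernel_def using t_pos[OF assms]
  by (subst powr_power) (auto simp: algebra_simps)

lemma sum_P_ml_term_concave:
  assumes "real (Suc k) * \<alpha> \<le> 1"
  shows "(\<Sum>j=1..n. P n j * ml_term k j) \<le> ml_term (Suc k) n"
proof -
  have "(\<Sum>j=1..n. P n j * ml_term k j)
      = (\<Sum>j=1..n. P n j * frac_kernel (1 - \<alpha> + real (Suc k) * \<alpha>) (t j))"
    by (intro sum.cong) (auto simp only: ml_term_frac_kernel atLeastAtMost_iff)
  also have "\<dots> \<le> ml_term (Suc k) n"
    unfolding ml_term_Suc by (rule sum_P_frac_power_concave) (use assms \<alpha> in auto)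
  finally show ?thesis .
qed

lemma sum_P_ml_term:
  assumes steps: "\<And>i. 1 \<le> i \<Longrightarrow> step t i \<le> step t (Suc i)" and "1 \<le> n"
  shows "(\<Sum>j=1..n-1. P n j * ml_term k j) \<le> ml_term (Suc k) n"
proof (cases "real (Suc k) * \<alpha> \<le> 1")
  case True
  have "(\<Sum>j=1..n-1. P n j * ml_term k j) \<le> (\<Sum>j=1..n. P n j * ml_term k j)"
    by (rule sum_mono2) (auto intro!: mult_nonneg_nonneg P_nonneg ml_term_nonneg)
  then show ?thesis using sum_P_ml_term_concave[OF True, of n] by simp
next
  case False
  have "(\<Sum>j=1..n-1. P n j * ml_term k j)
      = (\<Sum>j=1..n-1. P n j * frac_kernel (1 - \<alpha> + real (Suc k) * \<alpha>) (t j))"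
    by (intro sum.cong) (auto simp only: ml_term_frac_kernel atLeastAtMost_iff)
  also have "\<dots> \<le> ml_term (Suc k) n"
    unfolding ml_term_Suc by (rule sum_P_frac_power_convex) (use assms False in auto)
  finally show ?thesis .
qed

text \<open>The bound is proved with the Mittag-Leffler series truncated at the index \<open>j\<close>: the value at \<open>j\<close> depends
on earlier values only, and one step of the recursion raises the order of each term by one. Hence up
to the index \<open>m \<le> 1/\<alpha>\<close> all powers in the argument are concave. The square on the left is turned
into a linear inequality by dividing by \<open>v\<^sub>j\<close>, which is possible if \<open>v\<^sub>j\<close> dominates all earlier values;
if an earlier value is larger, its bound is already sufficient. For \<open>j = 1\<close> the second lag refers to
\<open>v\<^sub>0\<close>, since subtraction of natural numbers is truncated.\<close>

lemma L1_gronwall: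
  fixes v \<xi> :: "nat \<Rightarrow> real"
  assumes steps: "\<And>i. 1 \<le> i \<Longrightarrow> step t i \<le> step t (Suc i)"
    and v: "\<And>j. 0 \<le> v j" and \<xi>: "\<And>j. 0 \<le> \<xi> j"
    and coef: "0 \<le> l" "0 \<le> a" "0 \<le> b" and \<delta>: "1 < \<delta>"
    and energy: "\<And>j. 1 \<le> j \<Longrightarrow> j \<le> n \<Longrightarrow> D j (\<lambda>i. (v i)\<^sup>2)
          \<le> l * (v j)\<^sup>2 + a * (v (j - 1))\<^sup>2 + b * (v (j - 2))\<^sup>2 + 2 * \<xi> j * v j"
    and small: "\<And>j. 1 \<le> j \<Longrightarrow> j \<le> n \<Longrightarrow> l * P j j \<le> 1 / \<delta>"
    and m: "1 \<le> m" "real m * \<alpha> \<le> 1"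
    and \<mu>_init: "\<delta> / (\<delta> - 1) * (l + a + b) \<le> \<mu>"
    and \<mu>: "\<And>j. m < j \<Longrightarrow> j \<le> n \<Longrightarrow>
          \<delta> / (\<delta> - 1) * ((l + a + b) * (1 + P j j / P j (j - 1))) \<le> \<mu>"
    and F0: "v 0 \<le> F"
    and F: "\<And>j. 1 \<le> j \<Longrightarrow> j \<le> n \<Longrightarrow> v 0 + (\<Sum>i=1..j. P j i * \<xi> i) \<le> F"
  shows "j \<le> n \<Longrightarrow> v j \<le> 2 * (\<delta> / (\<delta> - 1)) * F * (\<Sum>k\<le>j. \<mu> ^ k * ml_term k j)"
proof (induction j rule: less_induct)
  case (less j)
  define C where "C = \<delta> / (\<delta> - 1)"
  define G where "G = 2 * C * F"
  have C: "1 \<le> C" "C * (1 - 1 / \<delta>) = 1" using \<delta> by (auto simp: C_def field_simps)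
  have F_nonneg: "0 \<le> F" using F0 v[of 0] by simp
  have FG: "F \<le> G" using mult_right_mono[OF C(1) F_nonneg] F_nonneg by (simp add: G_def)
  have G0: "0 \<le> G" using F_nonneg C by (simp add: G_def)
  have \<mu>0: "0 \<le> \<mu>"
    using \<mu>_init coef \<delta> by (intro order_trans[OF _ \<mu>_init] mult_nonneg_nonneg) auto
  have terms: "0 \<le> \<mu> ^ k * ml_term k i" for k i
    using \<mu>0 ml_term_nonneg by simp
  have IH: "v i \<le> G * (\<Sum>k\<le>i. \<mu> ^ k * ml_term k i)" if "i < j" for i
    using less.IH[OF that] less.prems that by (simp add: G_def C_def)
  have S_mono: "(\<Sum>k\<le>i. \<mu> ^ k * ml_term k i) \<le> (\<Sum>k\<le>i'. \<mu> ^ k * ml_term k i')" if "i \<le> i'" for i i'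
  proof -
    have "(\<Sum>k\<le>i. \<mu> ^ k * ml_term k i) \<le> (\<Sum>k\<le>i. \<mu> ^ k * ml_term k i')"
      using that \<mu>0 by (intro sum_mono mult_left_mono ml_term_mono) auto
    also have "\<dots> \<le> (\<Sum>k\<le>i'. \<mu> ^ k * ml_term k i')"
      using that by (intro sum_mono2 terms) auto
    finally show ?thesis .
  qed
  have "v j \<le> G * (\<Sum>k\<le>j. \<mu> ^ k * ml_term k j)"
  proof (cases "j = 0 \<or> (\<exists>i<j. v j < v i) \<or> v j = 0")
    case True
    then consider "j = 0" | "\<exists>i<j. v j < v i" | "v j = 0" by blast
    then show ?thesis
    proof cases
      case 1
      then show ?thesis using F0 FG by (simp add: ml_term_def t_0)
    next
      case 2
      then obtain i where i: "i < j" "v j < v i" by blast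
      then show ?thesis
        using IH[OF i(1)] mult_left_mono[OF S_mono[of i j] G0] by simp
    next
      case 3
      then show ?thesis using G0 terms by (simp add: sum_nonneg)
    qed
  next
    case False
    then have j: "1 \<le> j" and vi: "\<And>i. i \<le> j \<Longrightarrow> v i \<le> v j" and vj: "0 < v j"
      using v[of j] by (force simp: not_less le_less)+
    \<comment> \<open>All contributions except the implicit one, the initial value and the data.\<close>
    define R where "R = l * (\<Sum>i=1..j-1. P j i * v i)
       + (\<Sum>i=1..j. P j i * (a * v (i - 1) + b * v (i - 2)))"
    have Pnn: "0 \<le> P j i" if "i \<in> {1..j}" for i using P_nonneg that by auto
    have "(v j)\<^sup>2 - (v 0)\<^sup>2 = (\<Sum>i=1..j. P j i * D i (\<lambda>i. (v i)\<^sup>2))"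
      by (simp only: sum_P_D)
    also have "\<dots> \<le> (\<Sum>i=1..j. P j i * (v j * (l * v i + a * v (i - 1) + b * v (i - 2) + 2 * \<xi> i)))"
    proof (intro sum_mono mult_left_mono Pnn)
      fix i assume i: "i \<in> {1..j}"
      have sq: "(v k)\<^sup>2 \<le> v j * v k" if "k \<le> j" for k
        using mult_right_mono[OF vi[OF that] v[of k]] by (simp add: power2_eq_square)
      have "D i (\<lambda>i. (v i)\<^sup>2) \<le> l * (v i)\<^sup>2 + a * (v (i - 1))\<^sup>2 + b * (v (i - 2))\<^sup>2 + 2 * \<xi> i * v i"
        using energy[of i] i less.prems by simp
      also have "\<dots> \<le> l * (v j * v i) + a * (v j * v (i - 1)) + b * (v j * v (i - 2)) + 2 * \<xi> i * v j"
        using i coef \<xi>[of i] vi[of i] by (intro add_mono mult_left_mono sq) auto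
      finally show "D i (\<lambda>i. (v i)\<^sup>2) \<le> v j * (l * v i + a * v (i - 1) + b * v (i - 2) + 2 * \<xi> i)"
        by (simp add: algebra_simps)
    qed
    finally have "(v j)\<^sup>2 \<le> (v 0)\<^sup>2
       + v j * (\<Sum>i=1..j. P j i * (l * v i + a * v (i - 1) + b * v (i - 2) + 2 * \<xi> i))"
      by (simp add: sum_distrib_left algebra_simps)
    also have "(v 0)\<^sup>2 \<le> v j * v 0"
      using mult_right_mono[OF vi[of 0] v[of 0]] by (simp add: power2_eq_square)
    finally have "v j * v j \<le>
       v j * (v 0 + (\<Sum>i=1..j. P j i * (l * v i + a * v (i - 1) + b * v (i - 2) + 2 * \<xi> i)))"
      by (simp add: power2_eq_square algebra_simps)
    then have "v j \<le> v 0 + (\<Sum>i=1..j. P j i * (l * v i + a * v (i - 1) + b * v (i - 2) + 2 * \<xi> i))"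
      using vj by simp
    also have "(\<Sum>i=1..j. P j i * (l * v i + a * v (i - 1) + b * v (i - 2) + 2 * \<xi> i))
        = l * (\<Sum>i=1..j. P j i * v i) + (\<Sum>i=1..j. P j i * (a * v (i - 1) + b * v (i - 2)))
          + 2 * (\<Sum>i=1..j. P j i * \<xi> i)"
      by (simp add: sum_distrib_left sum.distrib algebra_simps)
    also have "(\<Sum>i=1..j. P j i * v i) = (\<Sum>i=1..j-1. P j i * v i) + P j j * v j"
      using j by (cases j) auto
    finally have "v j - l * P j j * v j \<le> (v 0 + 2 * (\<Sum>i=1..j. P j i * \<xi> i)) + R"
      by (simp add: R_def algebra_simps)
    also have "\<dots> \<le> 2 * F + R" using F[of j] j less.prems v[of 0] by linarith
    finally have 1: "v j - l * P j j * v j \<le> 2 * F + R" .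
    \<comment> \<open>The implicit term is at most \<open>v j / \<delta>\<close> and moves to the left-hand side.\<close>
    have "(1 - 1 / \<delta>) * v j \<le> 2 * F + R"
      using mult_right_mono[OF small[of j] v[of j]] j less.prems 1 by (simp add: algebra_simps)
    then have "C * ((1 - 1 / \<delta>) * v j) \<le> C * (2 * F + R)"
      using C by (intro mult_left_mono) auto
    moreover have "C * ((1 - 1 / \<delta>) * v j) = v j"
      using C(2) by (metis mult.assoc mult_1)
    ultimately have vR: "v j \<le> G + C * R"
      by (simp add: G_def algebra_simps)
    \<comment> \<open>A common truncation order for all earlier values, at the mesh point \<open>i\<close>.\<close>
    define A where "A i = (\<Sum>k\<le>j-1. \<mu> ^ k * ml_term k i)" for i
    have A0: "0 \<le> A i" for i unfolding A_def by (intro sum_nonneg terms)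
    have A_mono: "A i \<le> A i'" if "i \<le> i'" for i i'
      unfolding A_def using that \<mu>0 by (intro sum_mono mult_left_mono ml_term_mono) auto
    have vA: "v i \<le> G * A i" if "i < j" for i
    proof -
      have "(\<Sum>k\<le>i. \<mu> ^ k * ml_term k i) \<le> A i"
        unfolding A_def using that by (intro sum_mono2 terms) auto
      then show ?thesis using IH[OF that] mult_left_mono[OF _ G0] by fastforce
    qed
    have vA': "v i \<le> G * A i'" if "i < j" "i \<le> i'" for i i'
      using vA[OF that(1)] mult_left_mono[OF A_mono[OF that(2)] G0] by linarith
    have lag: "a * v (i - 1) + b * v (i - 2) \<le> (a + b) * (G * A i')"
      if "i - 1 < j" "i - 1 \<le> i'" for i i'
    proof -
      have "a * v (i - 1) + b * v (i - 2) \<le> a * (G * A i') + b * (G * A i')"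
        using that coef by (intro add_mono mult_left_mono vA') auto
      then show ?thesis by (simp add: algebra_simps)
    qed
    define X where "X = (\<Sum>k\<le>j-1. \<mu> ^ k * ml_term (Suc k) j)"
    have X0: "0 \<le> X" unfolding X_def using \<mu>0 ml_term_nonneg by (intro sum_nonneg) auto
    have lower: "(\<Sum>i=1..j-1. P j i * v i) \<le> G * (\<Sum>i=1..j-1. P j i * A i)"
    proof -
      have "(\<Sum>i=1..j-1. P j i * v i) \<le> (\<Sum>i=1..j-1. P j i * (G * A i))"
        by (intro sum_mono mult_left_mono vA Pnn) auto
      then show ?thesis by (simp add: sum_distrib_left algebra_simps)
    qed
    have "C * R \<le> G * (\<mu> * X)"
    proof (cases "j \<le> m")
      case True
      \<comment> \<open>Few steps: all powers that occur are concave, so the full sum can be used.\<close>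
      let ?Y = "\<Sum>i=1..j. P j i * A i"
      have "(\<Sum>i=1..j-1. P j i * A i) \<le> ?Y"
        by (intro sum_mono2 mult_nonneg_nonneg Pnn A0) auto
      then have "(\<Sum>i=1..j-1. P j i * v i) \<le> G * ?Y"
        using lower mult_left_mono[OF _ G0] by fastforce
      moreover have "(\<Sum>i=1..j. P j i * (a * v (i - 1) + b * v (i - 2)))
          \<le> (\<Sum>i=1..j. P j i * ((a + b) * (G * A i)))"
        by (intro sum_mono mult_left_mono lag Pnn) auto
      then have "(\<Sum>i=1..j. P j i * (a * v (i - 1) + b * v (i - 2))) \<le> (a + b) * (G * ?Y)"
        by (simp add: sum_distrib_left algebra_simps)
      ultimately have "R \<le> l * (G * ?Y) + (a + b) * (G * ?Y)"
        unfolding R_def using coef by (intro add_mono mult_left_mono) auto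
      then have "C * R \<le> C * ((l + a + b) * (G * ?Y))"
        using C by (intro mult_left_mono) (auto simp: algebra_simps)
      also have "\<dots> = (C * (l + a + b)) * (G * ?Y)" by simp
      also have "\<dots> \<le> \<mu> * (G * ?Y)"
        using \<mu>_init G0 A0 Pnn
        by (intro mult_right_mono mult_nonneg_nonneg sum_nonneg) (auto simp: C_def)
      also have "\<mu> * (G * ?Y) \<le> \<mu> * (G * X)"
      proof (intro mult_left_mono \<mu>0 G0)
        have "?Y = (\<Sum>k\<le>j-1. \<mu> ^ k * (\<Sum>i=1..j. P j i * ml_term k i))"
          unfolding A_def sum_distrib_left by (subst sum.swap) (simp add: algebra_simps)
        also have "\<dots> \<le> X"
          unfolding X_def
        proof (intro sum_mono mult_left_mono sum_P_ml_term_concave)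
          fix k assume "k \<in> {..j-1}"
          then have "real (Suc k) \<le> real m" using True j by auto
          then show "real (Suc k) * \<alpha> \<le> 1"
            using m(2) \<alpha> mult_right_mono[of "real (Suc k)" "real m" \<alpha>] by linarith
        qed (use \<mu>0 in auto)
        finally show "?Y \<le> X" .
      qed
      finally show ?thesis by (simp add: algebra_simps)
    next
      case False
      let ?Y = "\<Sum>i=1..j-1. P j i * A i" and ?\<rho> = "P j j / P j (j - 1)"
      have j2: "2 \<le> j" "m < j" using False m(1) by auto
      have \<rho>: "0 \<le> ?\<rho>" using P_diag_pos[OF j] P_subdiag_pos[OF j2(1)] by simp
      \<comment> \<open>The summand \<open>i = j\<close> of the lagged terms is charged to the summand \<open>i = j - 1\<close>.\<close>
      have "P j (j - 1) * A (j - 1) \<le> ?Y"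
        by (rule member_le_sum) (use j2 in \<open>auto intro!: mult_nonneg_nonneg Pnn A0\<close>)
      then have "?\<rho> * (P j (j - 1) * A (j - 1)) \<le> ?\<rho> * ?Y"
        using \<rho> by (rule mult_left_mono)
      then have last: "P j j * A (j - 1) \<le> ?\<rho> * ?Y"
        using P_subdiag_pos[OF j2(1)] by simp
      have "(\<Sum>i=1..j. P j i * (a * v (i - 1) + b * v (i - 2)))
          = (\<Sum>i=1..j-1. P j i * (a * v (i - 1) + b * v (i - 2)))
            + P j j * (a * v (j - 1) + b * v (j - 2))"
        using j by (cases j) auto
      also have "\<dots> \<le> (\<Sum>i=1..j-1. P j i * ((a + b) * (G * A i)))
            + P j j * ((a + b) * (G * A (j - 1)))"
        using j by (intro add_mono sum_mono mult_left_mono lag Pnn) auto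
      also have "\<dots> = (a + b) * G * (?Y + P j j * A (j - 1))"
        by (simp add: sum_distrib_left algebra_simps)
      also have "\<dots> \<le> (a + b) * G * (?Y + ?\<rho> * ?Y)"
        using last coef G0 by (intro mult_left_mono) auto
      finally have lagsum: "(\<Sum>i=1..j. P j i * (a * v (i - 1) + b * v (i - 2)))
          \<le> (a + b) * (G * ((1 + ?\<rho>) * ?Y))" by (simp add: algebra_simps)
      have Y0: "0 \<le> ?Y" using A0 Pnn by (intro sum_nonneg mult_nonneg_nonneg) auto
      have "?Y \<le> (1 + ?\<rho>) * ?Y"
        using mult_right_mono[OF _ Y0, of 1 "1 + ?\<rho>"] \<rho> by simp
      then have "(\<Sum>i=1..j-1. P j i * v i) \<le> G * ((1 + ?\<rho>) * ?Y)"
        using lower mult_left_mono[OF _ G0] by fastforce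
      then have "R \<le> l * (G * ((1 + ?\<rho>) * ?Y)) + (a + b) * (G * ((1 + ?\<rho>) * ?Y))"
        unfolding R_def using coef lagsum by (intro add_mono mult_left_mono) auto
      then have "C * R \<le> C * (l * (G * ((1 + ?\<rho>) * ?Y)) + (a + b) * (G * ((1 + ?\<rho>) * ?Y)))"
        using C by (intro mult_left_mono) auto
      also have "\<dots> = (C * ((l + a + b) * (1 + ?\<rho>))) * (G * ?Y)" by algebra
      also have "\<dots> \<le> \<mu> * (G * ?Y)"
        using \<mu>[OF j2(2)] less.prems G0 Y0
        by (intro mult_right_mono mult_nonneg_nonneg) (auto simp: C_def)
      also have "\<mu> * (G * ?Y) \<le> \<mu> * (G * X)"
      proof (intro mult_left_mono \<mu>0 G0)
        have "?Y = (\<Sum>k\<le>j-1. \<mu> ^ k * (\<Sum>i=1..j-1. P j i * ml_term k i))"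
          unfolding A_def sum_distrib_left by (subst sum.swap) (simp add: algebra_simps)
        also have "\<dots> \<le> X"
          unfolding X_def by (intro sum_mono mult_left_mono sum_P_ml_term steps j) (use \<mu>0 in auto)
        finally show "?Y \<le> X" .
      qed
      finally show ?thesis by (simp add: algebra_simps)
    qed
    \<comment> \<open>The orders have been raised by one; the new term of order zero comes from the data and the initial value.\<close>
    then have "v j \<le> G * (1 + \<mu> * X)" using vR by (simp add: algebra_simps)
    also have "1 + \<mu> * X = (\<Sum>k\<le>Suc (j-1). \<mu> ^ k * ml_term k j)"
      using t_pos[OF j] \<alpha>
      by (subst sum.atMost_Suc_shift) (simp add: X_def sum_distrib_left ml_term_def mult.assoc)
    finally show ?thesis using j by simp
  qed
  then show ?case by (simp add: G_def C_def)
qed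

text \<open>The ratio is \<open>K\<^sub>n\<^sub>-\<^sub>1\<^sub>,\<^sub>n\<^sub>-\<^sub>1 / (K\<^sub>n\<^sub>,\<^sub>n - K\<^sub>n\<^sub>,\<^sub>n\<^sub>-\<^sub>1)\<close>. With \<open>x\<close>, \<open>y\<close> the last two steps, its denominator is
\<open>(x+y)/x \<cdot> (y\<^sup>-\<^sup>\<alpha> - (x+y)\<^sup>-\<^sup>\<alpha>) / \<Gamma>(2-\<alpha>)\<close>, and the mean value theorem bounds it from below.\<close>

lemma P_ratio_bound:
  assumes "2 \<le> n"
  shows "P n n / P n (n - 1) \<le> (1 + step_ratio t n) powr \<alpha> / \<alpha>"
proof -
  let ?x = "step t (n - 1)" and ?y = "step t n"
  have x: "0 < ?x" and y: "0 < ?y" using step_pos assms by auto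
  have G: "0 < Gamma (2 - \<alpha>)" using \<alpha> by simp
  have mono: "K n (n - 1) < K n n" using K_strict_mono[of "n - 1" n] assms by simp
  have ratio: "P n n / P n (n - 1) = K (n - 1) (n - 1) / (K n n - K n (n - 1))"
    using P_subdiag[OF assms] P_diag_pos[of n] K_pos[of "n - 1" "n - 1"] mono assms
    by (simp add: field_simps)
  have xy: "t n - t (n - 1 - 1) = ?x + ?y" "t n - t (n - 1) = ?y" by (simp_all add: step_def)
  have "\<exists>z>?y. z < ?x + ?y \<and> (?x + ?y) powr (- \<alpha>) - ?y powr (- \<alpha>)
       = (?x + ?y - ?y) * (- \<alpha> * z powr (- \<alpha> - 1))"
    by (rule MVT2) (use x y in \<open>auto intro!: derivative_eq_intros\<close>)
  then obtain z where z: "?y < z" "z < ?x + ?y"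
    "?y powr (- \<alpha>) - (?x + ?y) powr (- \<alpha>) = \<alpha> * ?x * z powr (- \<alpha> - 1)"
    by (auto simp: algebra_simps)
  have zz: "(?x + ?y) powr (- \<alpha> - 1) \<le> z powr (- \<alpha> - 1)"
    using z y \<alpha> by (intro powr_mono2') auto
  have p: "s powr (1 - \<alpha>) = s * s powr (- \<alpha>)" if "s > 0" for s
    using that by (simp add: powr_diff powr_minus field_simps)
  have "\<alpha> * (?x + ?y) powr (- \<alpha>) = (?x + ?y) / ?x * (\<alpha> * ?x * (?x + ?y) powr (- \<alpha> - 1))"
    using x y by (simp add: powr_diff)
  also have "\<dots> \<le> (?x + ?y) / ?x * (\<alpha> * ?x * z powr (- \<alpha> - 1))"
    using zz x y \<alpha> by (intro mult_left_mono) auto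
  also have "\<dots> = (?x + ?y) / ?x * (?y powr (- \<alpha>) - (?x + ?y) powr (- \<alpha>))"
    using z(3) by simp
  also have "\<dots> = ?y powr (- \<alpha>) - ((?x + ?y) powr (1 - \<alpha>) - ?y powr (1 - \<alpha>)) / ?x"
    using x y p[of ?y] p[of "?x + ?y"] by (simp add: field_simps)
  also have "\<dots> = Gamma (2 - \<alpha>) * (K n n - K n (n - 1))"
  proof -
    have "Gamma (2 - \<alpha>) * K n n = ?y powr (- \<alpha>)"
      using K_diag[of n] assms G by simp
    moreover have "Gamma (2 - \<alpha>) * K n (n - 1) = ((?x + ?y) powr (1 - \<alpha>) - ?y powr (1 - \<alpha>)) / ?x"
      using K_eq[of "n - 1" n] assms G unfolding xy by simp
    ultimately show ?thesis by (simp add: right_diff_distrib)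
  qed
  finally have low: "\<alpha> * (?x + ?y) powr (- \<alpha>) \<le> Gamma (2 - \<alpha>) * (K n n - K n (n - 1))" .
  have "P n n / P n (n - 1) = ?x powr (- \<alpha>) / (Gamma (2 - \<alpha>) * (K n n - K n (n - 1)))"
    unfolding ratio using K_diag[of "n - 1"] assms by simp
  also have "\<dots> \<le> ?x powr (- \<alpha>) / (\<alpha> * (?x + ?y) powr (- \<alpha>))"
    using low x y \<alpha> mono G by (intro divide_left_mono mult_pos_pos) auto
  also have "\<dots> = ((?x + ?y) / ?x) powr \<alpha> / \<alpha>"
    using x y by (simp add: powr_divide powr_minus field_simps)
  also have "(?x + ?y) / ?x = 1 + step_ratio t n"
    using x by (simp add: step_ratio_def field_simps)
  finally show ?thesis .
qed

text \<open>Bounded step ratios bound the kernel ratios, so the sequence is bounded as well as increasing.\<close>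

lemma Lambda_seq_le_lim:
  assumes "0 \<le> Lam" and "1 \<le> m" and bound: "\<And>j. m < j \<Longrightarrow> step_ratio t j \<le> r"
  shows "Lambda_seq \<alpha> t m Lam n \<le> lim (Lambda_seq \<alpha> t m Lam)"
proof -
  let ?\<rho> = "\<lambda>j. P j j / P j (j - 1)"
  let ?L = "Lambda_seq \<alpha> t m Lam"
  have \<rho>0: "0 \<le> ?\<rho> j" if "m < j" for j
    using P_diag_pos[of j] P_subdiag_pos[of j] that assms(2) by simp
  have "?\<rho> j \<le> (1 + r) powr \<alpha> / \<alpha>" if "m < j" for j
  proof -
    have "?\<rho> j \<le> (1 + step_ratio t j) powr \<alpha> / \<alpha>"
      using P_ratio_bound[of j] that assms(2) by simp
    also have "0 \<le> step_ratio t j"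
      using less_imp_le[OF step_pos[of j]] less_imp_le[OF step_pos[of "j - 1"]] that assms(2)
      unfolding step_ratio_def by (intro divide_nonneg_nonneg) auto
    then have "(1 + step_ratio t j) powr \<alpha> / \<alpha> \<le> (1 + r) powr \<alpha> / \<alpha>"
      using bound[OF that] \<alpha> by (intro divide_right_mono powr_mono2) auto
    finally show ?thesis .
  qed
  then have ub: "Max (?\<rho> ` {m + 1..i}) \<le> (1 + r) powr \<alpha> / \<alpha>" if "m < i" for i
    using that by (subst Max_le_iff) auto
  have nn: "0 \<le> Max (?\<rho> ` {m + 1..i})" if "m < i" for i
    using that \<rho>0[of i] by (subst Max_ge_iff) auto
  have "incseq ?L"
  proof (rule incseq_SucI)
    fix i
    show "?L i \<le> ?L (Suc i)"
    proof (cases "i \<le> m")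
      case True
      then show ?thesis
        using nn[of "Suc i"] assms(1) by (auto simp: Lambda_seq_def algebra_simps intro!: mult_nonneg_nonneg)
    next
      case False
      then have "Max (?\<rho> ` {m + 1..i}) \<le> Max (?\<rho> ` {m + 1..Suc i})"
        by (intro Max_mono) auto
      then show ?thesis using False assms(1) by (auto simp: Lambda_seq_def intro!: mult_left_mono)
    qed
  qed
  moreover have "?L i \<le> Lam * (1 + (1 + r) powr \<alpha> / \<alpha>)" for i
    using ub[of i] assms(1) \<alpha>
    by (auto simp: Lambda_seq_def intro!: mult_left_mono mult_le_cancel_left1[THEN iffD2])
  ultimately have "convergent ?L"
    using incseq_convergent[of ?L "Lam * (1 + (1 + r) powr \<alpha> / \<alpha>)"] by (metis convergentI)
  with \<open>incseq ?L\<close> show ?thesis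
    by (intro incseq_le) (auto simp: convergent_LIMSEQ_iff)
qed

end

section \<open>Graded meshes\<close>

text \<open>Cauchy's mean value theorem for \<open>s\<^sup>\<gamma>\<close> and \<open>(s-1)\<^sup>\<gamma>\<close> on \<open>[x-1, x]\<close>. It writes the ratio of two consecutive
steps of a graded mesh as a decreasing function of an intermediate point.\<close>

lemma powr_cauchy_mean_value:
  fixes \<gamma> x :: real
  assumes "1 \<le> \<gamma>" "2 \<le> x"
  shows "\<exists>\<xi>. x - 1 < \<xi> \<and> \<xi> < x \<and>
     (x powr \<gamma> - (x - 1) powr \<gamma>) / ((x - 1) powr \<gamma> - (x - 2) powr \<gamma>) = (\<xi> / (\<xi> - 1)) powr (\<gamma> - 1)"
proof -
  define p where "p = x powr \<gamma> - (x - 1) powr \<gamma>"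
  define q where "q = (x - 1) powr \<gamma> - (x - 2) powr \<gamma>"
  have q: "0 < q" using assms by (simp add: q_def powr_less_mono2)
  \<comment> \<open>This combination takes equal values at both ends, so its derivative vanishes in between.\<close>
  let ?h = "\<lambda>s. p * (s - 1) powr \<gamma> - q * s powr \<gamma>"
  let ?h' = "\<lambda>s. p * (\<gamma> * (s - 1) powr (\<gamma> - 1)) - q * (\<gamma> * s powr (\<gamma> - 1))"
  have "continuous_on {x - 1..x} ?h"
    using assms
    by (intro continuous_on_diff continuous_on_mult continuous_on_powr' continuous_on_const
        continuous_on_id) auto
  moreover have "(?h has_derivative (*) (?h' s)) (at s)" if "x - 1 < s" "s < x" for s
  proof -
    have "(?h has_real_derivative ?h' s) (at s)"
      using that assms by (auto intro!: derivative_eq_intros)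
    then show ?thesis by (simp add: has_field_derivative_def)
  qed
  ultimately obtain \<xi> where \<xi>: "x - 1 < \<xi>" "\<xi> < x" "?h x - ?h (x - 1) = ?h' \<xi> * (x - (x - 1))"
    using mvt[of "x - 1" x ?h "\<lambda>s. (*) (?h' s)"] by auto
  have "?h x - ?h (x - 1) = 0"
    by (simp add: p_def q_def algebra_simps)
  then have "\<gamma> * (p * (\<xi> - 1) powr (\<gamma> - 1)) = \<gamma> * (q * \<xi> powr (\<gamma> - 1))"
    using \<xi>(3) by (simp add: mult.left_commute)
  then have "p * (\<xi> - 1) powr (\<gamma> - 1) = q * \<xi> powr (\<gamma> - 1)"
    using assms by simp
  then have "p / q = (\<xi> / (\<xi> - 1)) powr (\<gamma> - 1)"
    using \<xi> assms q by (simp add: powr_divide field_simps)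
  then show ?thesis using \<xi> unfolding p_def q_def by blast
qed

locale graded_time_mesh =
  fixes N :: nat and \<gamma> T :: real
  assumes N: "1 \<le> N" and \<gamma>: "1 \<le> \<gamma>" and T: "0 < T"
begin

abbreviation "t \<equiv> graded_mesh N \<gamma> T"

lemma graded_mesh_eq: "t n = T / real N powr \<gamma> * real n powr \<gamma>"
  by (simp add: graded_mesh_def powr_divide)

lemma graded_mesh_strict_mono: "strict_mono t"
  using N \<gamma> T unfolding graded_mesh_eq
  by (intro strict_monoI mult_strict_left_mono powr_less_mono2 divide_pos_pos) auto

lemma graded_mesh_N: "t N = T"
  using N by (simp add: graded_mesh_def)

lemma step_graded: "1 \<le> n \<Longrightarrow> step t n = T / real N powr \<gamma> * (real n powr \<gamma> - (real n - 1) powr \<gamma>)"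
  by (simp add: step_def graded_mesh_eq right_diff_distrib of_nat_diff)

lemma step_graded_pos: "1 \<le> n \<Longrightarrow> 0 < step t n"
  using graded_mesh_strict_mono by (simp add: step_def strict_mono_less)

lemma step_ratio_graded:
  assumes "2 \<le> n"
  shows "\<exists>\<xi>. real n - 1 < \<xi> \<and> \<xi> < real n \<and> step_ratio t n = (\<xi> / (\<xi> - 1)) powr (\<gamma> - 1)"
proof -
  let ?c = "T / real N powr \<gamma>"
  have c: "?c \<noteq> 0" using N T by simp
  have s1: "step t (n - 1) = ?c * ((real n - 1) powr \<gamma> - (real n - 2) powr \<gamma>)"
    using step_graded[of "n - 1"] assms by (simp add: of_nat_diff)
  have s2: "step t n = ?c * (real n powr \<gamma> - (real n - 1) powr \<gamma>)"
    using step_graded[of n] assms by simp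
  have "step_ratio t n = (real n powr \<gamma> - (real n - 1) powr \<gamma>)
       / ((real n - 1) powr \<gamma> - (real n - 2) powr \<gamma>)"
    unfolding step_ratio_def s1 s2 by (rule mult_divide_mult_cancel_left[OF c])
  then show ?thesis using powr_cauchy_mean_value[OF \<gamma>, of "real n"] assms by simp
qed

lemma step_ratio_graded_ge_1:
  assumes "2 \<le> n"
  shows "1 \<le> step_ratio t n"
proof -
  obtain \<xi> where "real n - 1 < \<xi>" "step_ratio t n = (\<xi> / (\<xi> - 1)) powr (\<gamma> - 1)"
    using step_ratio_graded[OF assms] by blast
  then show ?thesis using assms \<gamma> by (simp add: ge_one_powr_ge_zero)
qed

text \<open>The intermediate points for different indices lie in disjoint intervals, hence are ordered, and
\<open>\<xi>/(\<xi>-1)\<close> decreases.\<close>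

lemma step_ratio_graded_antimono:
  assumes "2 \<le> i" "i \<le> j"
  shows "step_ratio t j \<le> step_ratio t i"
proof (cases "i = j")
  case False
  obtain \<xi> where \<xi>: "real i - 1 < \<xi>" "\<xi> < real i" "step_ratio t i = (\<xi> / (\<xi> - 1)) powr (\<gamma> - 1)"
    using step_ratio_graded[OF assms(1)] by blast
  obtain \<eta> where \<eta>: "real j - 1 < \<eta>" "step_ratio t j = (\<eta> / (\<eta> - 1)) powr (\<gamma> - 1)"
    using step_ratio_graded[of j] assms by auto
  have "real i \<le> real j - 1" using False assms by linarith
  then have "\<eta> / (\<eta> - 1) \<le> \<xi> / (\<xi> - 1)"
    using \<xi> \<eta> assms by (simp add: field_simps)
  then show ?thesis
    unfolding \<xi>(3) \<eta>(2) using \<xi> \<eta> \<gamma> assms by (intro powr_mono2) auto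
qed simp

lemma step_graded_mono:
  assumes "1 \<le> n"
  shows "step t n \<le> step t (Suc n)"
  using step_ratio_graded_ge_1[of "Suc n"] step_graded_pos[OF assms] assms
  by (simp add: step_ratio_def)

lemma L1_mesh_graded: "0 < \<alpha> \<Longrightarrow> \<alpha> < 1 \<Longrightarrow> L1_mesh \<alpha> t"
  by unfold_locales (auto simp: graded_mesh_strict_mono graded_mesh_def)

end

lemma n_start_bounds:
  assumes "0 < \<alpha>" "\<alpha> < 1" "1 \<le> N"
  shows "1 \<le> n_start \<alpha> N" "real (n_start \<alpha> N) * \<alpha> \<le> 1"
proof -
  have "1 \<le> \<lfloor>1 / \<alpha>\<rfloor>" using assms by (simp add: le_floor_iff)
  then show "1 \<le> n_start \<alpha> N" using assms by (simp add: n_start_def le_nat_iff)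
  have "real (n_start \<alpha> N) \<le> real (nat \<lfloor>1 / \<alpha>\<rfloor>)" by (simp add: n_start_def)
  also have "\<dots> \<le> 1 / \<alpha>" using assms by simp
  finally show "real (n_start \<alpha> N) * \<alpha> \<le> 1" using assms by (simp add: field_simps)
qed

text \<open>The time-step restriction is a bound of the diagonal kernel \<open>P\<^sub>j\<^sub>j = \<Gamma>(2-\<alpha>) (\<Delta>t\<^sub>j)\<^sup>\<alpha>\<close>.\<close>

lemma (in L1_mesh) step_restriction_P_diag:
  assumes "0 < l" "0 < \<delta>" "1 \<le> j" and le: "step t j \<le> (\<delta> * l * Gamma (2 - \<alpha>)) powr (- 1 / \<alpha>)"
  shows "l * P j j \<le> 1 / \<delta>"
proof -
  let ?G = "\<delta> * l * Gamma (2 - \<alpha>)"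
  have G: "0 < Gamma (2 - \<alpha>)" "0 < ?G" using assms \<alpha> by auto
  have "step t j powr \<alpha> \<le> (?G powr (- 1 / \<alpha>)) powr \<alpha>"
    using le step_pos[OF assms(3)] \<alpha> by (intro powr_mono2) auto
  also have "\<dots> = ?G powr (- 1)" unfolding powr_powr using \<alpha> by simp
  also have "\<dots> = 1 / ?G" using less_imp_le[OF G(2)] by (simp only: powr_minus_divide powr_one)
  finally have "(l * Gamma (2 - \<alpha>)) * step t j powr \<alpha> \<le> (l * Gamma (2 - \<alpha>)) * (1 / ?G)"
    using assms G by (intro mult_left_mono) auto
  also have "\<dots> = 1 / \<delta>" using assms G by simp
  finally show ?thesis using P_diag_eq[OF assms(3)] by (simp add: mult.assoc)
qed

section \<open>Square integrable functions\<close>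

lemma L2_measurable: "f \<in> L2 U \<Longrightarrow> f \<in> borel_measurable (lebesgue_on U)"
  by (simp add: L2_def)

lemma L2_integrable_inner:
  assumes "f \<in> L2 U" "g \<in> L2 U"
  shows "integrable (lebesgue_on U) (\<lambda>x. f x \<bullet> g x)"
proof (rule Bochner_Integration.integrable_bound)
  show "integrable (lebesgue_on U) (\<lambda>x. (norm (f x))\<^sup>2 + (norm (g x))\<^sup>2)"
    using assms by (simp add: L2_def)
  show "(\<lambda>x. f x \<bullet> g x) \<in> borel_measurable (lebesgue_on U)"
    using assms by (intro borel_measurable_inner L2_measurable)
  have "\<bar>f x \<bullet> g x\<bar> \<le> (norm (f x))\<^sup>2 + (norm (g x))\<^sup>2" for x
    using Cauchy_Schwarz_ineq2[of "f x" "g x"] sum_squares_bound[of "norm (f x)" "norm (g x)"]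
      mult_nonneg_nonneg[OF norm_ge_zero[of "f x"] norm_ge_zero[of "g x"]]
    by linarith
  then show "AE x in lebesgue_on U. norm (f x \<bullet> g x) \<le> norm ((norm (f x))\<^sup>2 + (norm (g x))\<^sup>2)"
    by (simp add: abs_of_nonneg)
qed

lemma L2_bounded:
  assumes "f \<in> borel_measurable (lebesgue_on U)" "g \<in> L2 U"
    and "AE x in lebesgue_on U. norm (f x) \<le> M * norm (g x)"
  shows "f \<in> L2 U"
proof -
  have "integrable (lebesgue_on U) (\<lambda>x. (norm (f x))\<^sup>2)"
  proof (rule Bochner_Integration.integrable_bound)
    show "integrable (lebesgue_on U) (\<lambda>x. M\<^sup>2 * (norm (g x))\<^sup>2)"
      using assms(2) by (simp add: L2_def)
    show "(\<lambda>x. (norm (f x))\<^sup>2) \<in> borel_measurable (lebesgue_on U)"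
      using assms(1) by measurable
    show "AE x in lebesgue_on U. norm ((norm (f x))\<^sup>2) \<le> norm (M\<^sup>2 * (norm (g x))\<^sup>2)"
      using assms(3)
    proof eventually_elim
      case (elim x)
      then have "(norm (f x))\<^sup>2 \<le> (M * norm (g x))\<^sup>2" by (intro power_mono) auto
      then show ?case by (simp add: power_mult_distrib)
    qed
  qed
  then show ?thesis using assms(1) by (simp add: L2_def)
qed

lemma L2_add:
  assumes "f \<in> L2 U" "g \<in> L2 U"
  shows "(\<lambda>x. f x + g x) \<in> L2 U"
proof -
  have "(\<lambda>x. (norm (f x + g x))\<^sup>2) = (\<lambda>x. (norm (f x))\<^sup>2 + (norm (g x))\<^sup>2 + 2 * (f x \<bullet> g x))"
    by (auto simp: power2_norm_eq_inner inner_add inner_commute)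
  then show ?thesis
    using assms L2_integrable_inner[OF assms] by (auto simp: L2_def)
qed

lemma L2_scaleR: "f \<in> L2 U \<Longrightarrow> (\<lambda>x. a *\<^sub>R f x) \<in> L2 U"
  by (auto simp: L2_def power_mult_distrib)

lemma L2_diff:
  assumes "f \<in> L2 U" "g \<in> L2 U"
  shows "(\<lambda>x. f x - g x) \<in> L2 U"
  using L2_add[OF assms(1) L2_scaleR[OF assms(2), of "-1"]] by simp

lemma l2ip_commute: "l2ip U f g = l2ip U g f"
  by (simp add: l2ip_def inner_commute)

lemma l2ip_diff_left:
  "f \<in> L2 U \<Longrightarrow> g \<in> L2 U \<Longrightarrow> h \<in> L2 U \<Longrightarrow> l2ip U (\<lambda>x. f x - g x) h = l2ip U f h - l2ip U g h"
  by (simp add: l2ip_def inner_diff_left Bochner_Integration.integral_diff L2_integrable_inner)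

lemma l2ip_scaleR_left: "l2ip U (\<lambda>x. a *\<^sub>R f x) h = a * l2ip U f h"
  by (simp add: l2ip_def)

lemma l2ip_self_nonneg: "0 \<le> l2ip U f f"
  by (simp add: l2ip_def)

lemma l2norm_nonneg: "0 \<le> l2norm U f"
  by (simp add: l2norm_def l2ip_self_nonneg)

lemma l2norm_sq: "(l2norm U f)\<^sup>2 = l2ip U f f"
  by (simp add: l2norm_def l2ip_self_nonneg)

lemma l2ip_mono:
  assumes "f \<in> L2 U" "g \<in> L2 U" "f' \<in> L2 U" "g' \<in> L2 U"
    "AE x in lebesgue_on U. f x \<bullet> g x \<le> f' x \<bullet> g' x"
  shows "l2ip U f g \<le> l2ip U f' g'"
  unfolding l2ip_def by (intro integral_mono_AE L2_integrable_inner assms)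

lemma l2norm_diff_sq:
  assumes "f \<in> L2 U" "g \<in> L2 U"
  shows "(l2norm U (\<lambda>x. f x - g x))\<^sup>2 = (l2norm U f)\<^sup>2 - 2 * l2ip U f g + (l2norm U g)\<^sup>2"
proof -
  note d = L2_diff[OF assms]
  have "l2ip U (\<lambda>x. f x - g x) (\<lambda>x. f x - g x)
      = l2ip U f (\<lambda>x. f x - g x) - l2ip U g (\<lambda>x. f x - g x)"
    by (rule l2ip_diff_left[OF assms d])
  also have "\<dots> = l2ip U f f - l2ip U g f - (l2ip U f g - l2ip U g g)"
    using assms by (simp add: l2ip_commute[of _ _ "\<lambda>x. f x - g x"] l2ip_diff_left)
  finally show ?thesis by (simp add: l2norm_sq l2ip_commute[of U g f])
qed

lemma l2norm_scaleR_sq: "(l2norm U (\<lambda>x. a *\<^sub>R f x))\<^sup>2 = a\<^sup>2 * (l2norm U f)\<^sup>2"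
  unfolding l2norm_sq by (simp add: l2ip_def power2_eq_square)

lemma l2ip_Young:
  assumes "f \<in> L2 U" "g \<in> L2 U" "0 < e"
  shows "2 * l2ip U f g \<le> e * (l2norm U f)\<^sup>2 + 1 / e * (l2norm U g)\<^sup>2"
proof -
  have "0 \<le> (l2norm U (\<lambda>x. e *\<^sub>R f x - g x))\<^sup>2" by simp
  also have "\<dots> = e\<^sup>2 * (l2norm U f)\<^sup>2 - 2 * (e * l2ip U f g) + (l2norm U g)\<^sup>2"
    using l2norm_diff_sq[OF L2_scaleR[OF assms(1)] assms(2)]
    by (simp add: l2norm_scaleR_sq l2ip_scaleR_left)
  finally have "e * (2 * l2ip U f g) \<le> e * (e * (l2norm U f)\<^sup>2 + 1 / e * (l2norm U g)\<^sup>2)"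
    using assms(3) by (simp add: power2_eq_square algebra_simps)
  then show ?thesis using assms(3) by simp
qed

lemma l2ip_Cauchy_Schwarz:
  assumes "f \<in> L2 U" "g \<in> L2 U"
  shows "l2ip U f g \<le> l2norm U f * l2norm U g"
proof (cases "l2norm U f = 0 \<or> l2norm U g = 0")
  case False
  then have "0 < l2norm U f" "0 < l2norm U g" using l2norm_nonneg by (force simp: less_le)+
  then show ?thesis
    using l2ip_Young[OF assms, of "l2norm U g / l2norm U f"] by (simp add: power2_eq_square)
next
  case True
  \<comment> \<open>If one of the norms is zero, a suitable weight in Young's inequality excludes a positive product.\<close>
  have "l2ip U f g \<le> 0"
  proof (rule ccontr)
    assume "\<not> ?thesis"
    then have pos: "0 < l2ip U f g" by simp
    define F G where "F = (l2norm U f)\<^sup>2" and "G = (l2norm U g)\<^sup>2"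
    have FG: "F \<ge> 0" "G \<ge> 0" "F = 0 \<or> G = 0" using True by (auto simp: F_def G_def)
    have Y: "2 * l2ip U f g \<le> e * F + 1 / e * G" if "0 < e" for e
      using l2ip_Young[OF assms that] by (simp add: F_def G_def)
    show False
    proof (cases "F = 0")
      case True
      have "2 * l2ip U f g \<le> G / ((G + 1) / l2ip U f g)"
        using Y[of "(G + 1) / l2ip U f g"] True pos FG by (simp add: mult.commute)
      also have "\<dots> \<le> l2ip U f g" using pos FG by (simp add: field_simps)
      finally show False using pos by simp
    next
      case False
      then have "2 * l2ip U f g \<le> l2ip U f g / (F + 1) * F"
        using Y[of "l2ip U f g / (F + 1)"] pos FG by simp
      also have "\<dots> \<le> l2ip U f g" using pos FG by (simp add: field_simps)
      finally show False using pos by simp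
    qed
  qed
  then show ?thesis
    using l2norm_nonneg[of U f] l2norm_nonneg[of U g] by (smt (verit) mult_nonneg_nonneg)
qed

lemma L2_cmult: "f \<in> L2 U \<Longrightarrow> (\<lambda>x. a * f x :: real) \<in> L2 U"
  using L2_scaleR[of f U a] by simp

lemma l2ip_cmult_left: "l2ip U (\<lambda>x. a * f x :: real) h = a * l2ip U f h"
  using l2ip_scaleR_left[of U a f h] by simp

lemma l2ip_L1_deriv:
  fixes u :: "nat \<Rightarrow> 'a::euclidean_space \<Rightarrow> real"
  assumes u: "\<And>j. j \<le> n \<Longrightarrow> u j \<in> L2 U" and v: "v \<in> L2 U"
  shows "l2ip U (\<lambda>x. L1_deriv \<alpha> t n (\<lambda>j. u j x)) v = L1_deriv \<alpha> t n (\<lambda>j. l2ip U (u j) v)"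
proof -
  have I: "integrable (lebesgue_on U) (\<lambda>x. u j x * v x)" if "j \<le> n" for j
    using L2_integrable_inner[OF u[OF that] v] by simp
  have "l2ip U (\<lambda>x. L1_deriv \<alpha> t n (\<lambda>j. u j x)) v =
      (\<integral>x. (\<Sum>j=1..n. L1_kernel \<alpha> t n j * (u j x * v x - u (j - 1) x * v x)) \<partial>lebesgue_on U)"
    unfolding l2ip_def L1_deriv_def
    by (intro Bochner_Integration.integral_cong)
       (auto simp: sum_distrib_right left_diff_distrib mult.assoc intro!: sum.cong)
  also have "\<dots> = (\<Sum>j=1..n. L1_kernel \<alpha> t n j * (l2ip U (u j) v - l2ip U (u (j - 1)) v))"
    by (subst Bochner_Integration.integral_sum)
       (auto simp: l2ip_def I Bochner_Integration.integral_diff intro!: sum.cong)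
  finally show ?thesis by (simp add: L1_deriv_def)
qed

text \<open>Summation by parts: the coefficients of \<open>d\<^sub>0, ..., d\<^sub>n\<^sub>-\<^sub>1\<close> after the summation are nonpositive.\<close>

lemma abel_lower_bound:
  fixes K d :: "nat \<Rightarrow> real"
  assumes "\<And>j. 1 \<le> j \<Longrightarrow> j \<le> n \<Longrightarrow> 0 \<le> K j"
    and "\<And>j. 1 \<le> j \<Longrightarrow> j < n \<Longrightarrow> K j \<le> K (Suc j)"
    and "\<And>j. j \<le> n \<Longrightarrow> d j \<le> 0"
    and "1 \<le> n"
  shows "K n * d n \<le> (\<Sum>j=1..n. K j * (d j - d (j - 1)))"
  using assms(4,1-3)
proof (induction n rule: dec_induct)
  case base
  have "K 1 * d 0 \<le> 0" using base by (intro mult_nonneg_nonpos) auto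
  then show ?case by (simp add: algebra_simps)
next
  case (step n)
  have "(K (Suc n) - K n) * d n \<le> 0"
    using step.prems(2)[of n] step.prems(3)[of n] step.hyps by (intro mult_nonneg_nonpos) auto
  moreover have "K n * d n \<le> (\<Sum>j=1..n. K j * (d j - d (j - 1)))"
    using step by auto
  ultimately show ?case by (simp add: algebra_simps)
qed

text \<open>Since \<open>D\<close> annihilates constants, the difference of the two sides is \<open>D\<close> applied to
\<open>j \<mapsto> - \<parallel>u\<^sub>j - u\<^sub>n\<parallel>\<^sup>2\<close>. This sequence is nonpositive and vanishes at \<open>n\<close>, so that summation by parts
applies.\<close>

lemma (in L1_mesh) L1_deriv_energy:
  fixes u :: "nat \<Rightarrow> 'a::euclidean_space \<Rightarrow> real"
  assumes u: "\<And>j. j \<le> n \<Longrightarrow> u j \<in> L2 U" and n: "1 \<le> n"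
  shows "D n (\<lambda>j. (l2norm U (u j))\<^sup>2) \<le> 2 * l2ip U (\<lambda>x. D n (\<lambda>j. u j x)) (u n)"
proof -
  let ?d = "\<lambda>j. - (l2norm U (\<lambda>x. u j x - u n x))\<^sup>2"
  have d: "?d j = 2 * l2ip U (u j) (u n) - (l2norm U (u j))\<^sup>2 - (l2norm U (u n))\<^sup>2" if "j \<le> n" for j
    using l2norm_diff_sq[OF u[OF that] u[of n]] that by simp
  have "K n n * ?d n \<le> (\<Sum>j=1..n. K n j * (?d j - ?d (j - 1)))"
    by (rule abel_lower_bound)
       (use n K_pos K_strict_mono in \<open>auto intro: less_imp_le\<close>)
  moreover have "?d n = 0" by (simp add: l2norm_def l2ip_def)
  moreover have "(\<Sum>j=1..n. K n j * (?d j - ?d (j - 1))) =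
      (\<Sum>j=1..n. K n j * (2 * (l2ip U (u j) (u n) - l2ip U (u (j - 1)) (u n))
          - ((l2norm U (u j))\<^sup>2 - (l2norm U (u (j - 1)))\<^sup>2)))"
  proof (intro sum.cong refl arg_cong2[where f="(*)"])
    fix j assume "j \<in> {1..n}"
    then have j: "j \<le> n" "j - 1 \<le> n" by auto
    show "?d j - ?d (j - 1) = 2 * (l2ip U (u j) (u n) - l2ip U (u (j - 1)) (u n))
          - ((l2norm U (u j))\<^sup>2 - (l2norm U (u (j - 1)))\<^sup>2)"
      unfolding d[OF j(1)] d[OF j(2)] by simp
  qed
  moreover have "\<dots> = 2 * D n (\<lambda>j. l2ip U (u j) (u n)) - D n (\<lambda>j. (l2norm U (u j))\<^sup>2)"
    unfolding L1_deriv_def by (simp add: sum_distrib_left sum_subtractf[symmetric] algebra_simps)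
  moreover have "l2ip U (\<lambda>x. D n (\<lambda>j. u j x)) (u n) = D n (\<lambda>j. l2ip U (u j) (u n))"
    by (rule l2ip_L1_deriv) (use u in auto)
  ultimately show ?thesis by simp
qed

section \<open>Essential suprema and time slices\<close>

lemma AE_lebesgue_on_iff:
  "open U \<Longrightarrow> (AE x in lebesgue_on U. P x) \<longleftrightarrow> (AE x in lebesgue. x \<in> U \<longrightarrow> P x)"
  by (intro AE_restrict_space_iff) auto

text \<open>The exceptional null set can be chosen independently of \<open>t\<close>: collect those of a countable dense set
of times and extend to the others by continuity.\<close>

lemma AE_all_times:
  fixes f :: "'a \<Rightarrow> real \<Rightarrow> 'b::topological_space"
  assumes C: "closed C" and P: "\<And>t. t \<in> I \<Longrightarrow> AE x in M. f x t \<in> C"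
    and cont: "AE x in M. continuous_on I (f x)"
  shows "AE x in M. \<forall>t\<in>I. f x t \<in> C"
proof -
  obtain J where J: "countable J" "J \<subseteq> I" "I \<subseteq> closure J"
    using separable[of I] by blast
  have "AE x in M. \<forall>t\<in>J. f x t \<in> C"
    using J P by (subst AE_ball_countable) auto
  with cont show ?thesis
  proof eventually_elim
    case (elim x)
    have "closedin (top_of_set I) (I \<inter> f x -` C)"
      by (rule continuous_closedin_preimage[OF elim(1) C])
    then obtain S where S: "closed S" "I \<inter> f x -` C = I \<inter> S"
      unfolding closedin_closed by blast
    have "J \<subseteq> S" using J(2) elim(2) S(2) by blast
    then have "closure J \<subseteq> S" using S(1) by (rule closure_minimal)
    then show ?case using J(3) S(2) by blast
  qed
qed

lemma cylinder_sets_lebesgue: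
  fixes U :: "'a::euclidean_space set"
  assumes "open U"
  shows "U \<times> {0<..T::real} \<in> sets lebesgue"
proof -
  have "U \<times> {0<..T} \<in> sets (lborel \<Otimes>\<^sub>M lborel)" using assms by (intro pair_measureI) auto
  then show ?thesis unfolding lborel_prod by (rule sets_completionI_sets)
qed

text \<open>A null set of points \<open>x\<close> sweeps out a null set of the product space.\<close>

lemma AE_cylinder:
  fixes U :: "'a::euclidean_space set"
  assumes U: "open U" and Q: "AE x in lebesgue_on U. Q x"
  shows "AE z in lebesgue_on (U \<times> {0<..T::real}). z \<in> U \<times> {0<..T} \<and> Q (fst z)"
proof -
  have "AE x in lborel. x \<in> U \<longrightarrow> Q x"
    using Q unfolding AE_lebesgue_on_iff[OF U] AE_completion_iff .
  then obtain N where N: "N \<in> null_sets lborel" "{x. \<not> (x \<in> U \<longrightarrow> Q x)} \<subseteq> N"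
    by (auto simp: eventually_ae_filter)
  have "N \<times> UNIV \<in> null_sets (lborel \<Otimes>\<^sub>M (lborel :: real measure))"
  proof -
    have "emeasure (lborel \<Otimes>\<^sub>M (lborel :: real measure)) (N \<times> UNIV)
        = emeasure lborel N * emeasure lborel (UNIV :: real set)"
      by (rule lborel.emeasure_pair_measure_Times) (use N in auto)
    then show ?thesis using N by (auto simp: null_sets_def)
  qed
  then have "AE z in lborel. fst (z :: 'a \<times> real) \<in> U \<longrightarrow> Q (fst z)"
    unfolding lborel_prod using N(2)
    by (auto simp: eventually_ae_filter intro!: bexI[of _ "N \<times> UNIV"])
  then have "AE z in lebesgue. fst (z :: 'a \<times> real) \<in> U \<longrightarrow> Q (fst z)"
    by (rule AE_completion)
  then show ?thesis
    by (subst AE_restrict_space_iff)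
       (use cylinder_sets_lebesgue[OF U] in \<open>auto elim!: eventually_mono\<close>)
qed

lemma borel_measurable_lebesgue_on_AE:
  fixes f :: "'a::euclidean_space \<Rightarrow> 'b::euclidean_space"
  assumes S: "S \<in> sets lebesgue" and f: "f \<in> borel_measurable (lebesgue_on S)"
    and eq: "AE x in lebesgue_on S. f x = g x"
  shows "g \<in> borel_measurable (lebesgue_on S)"
proof -
  have "(\<lambda>x. if x \<in> S then f x else 0) \<in> borel_measurable lebesgue"
    by (rule borel_measurable_if_I[OF f S])
  moreover have "AE x in lebesgue. x \<in> S \<longrightarrow> f x = g x"
    using eq AE_restrict_space_iff[of S lebesgue] S by simp
  then have "AE x in lebesgue. (if x \<in> S then f x else 0) = (if x \<in> S then g x else 0)"
    by eventually_elim auto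
  ultimately have "(\<lambda>x. if x \<in> S then g x else 0) \<in> borel_measurable lebesgue"
    by (rule borel_measurable_AE)
  then show ?thesis by (rule borel_measurable_if_D)
qed

text \<open>By Fubini's theorem, for almost every \<open>x\<close> the bound by the essential supremum holds for almost every
\<open>t\<close>, and by continuity in time it then holds for every \<open>t\<close>. The uniform bound \<open>B\<close> makes the essential
supremum finite, so that its conversion to a real number is harmless.\<close>

lemma Linf_time_slice:
  fixes F :: "'a::euclidean_space \<Rightarrow> real \<Rightarrow> real"
  assumes U: "open U" 
    and meas: "(\<lambda>(x, t). F x t) \<in> borel_measurable (lebesgue_on (U \<times> {0<..T}))"
    and cont: "AE x in lebesgue_on U. continuous_on {0<..T} (F x)"
    and bound: "AE x in lebesgue_on U. \<forall>t\<in>{0<..T}. 0 \<le> F x t \<and> F x t \<le> B"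
  defines "L \<equiv> real_of_ereal (Linf_norm (lebesgue_on (U \<times> {0<..T})) (\<lambda>(x, t). F x t))"
  shows "AE x in lebesgue_on U. \<forall>t\<in>{0<..T}. F x t \<le> L" and "0 \<le> L"
proof -
  let ?I = "{0<..T}" and ?M = "lebesgue_on (U \<times> {0<..T})"
  let ?F = "\<lambda>(x, t). F x t"
  let ?E = "esssup ?M (\<lambda>z. ereal (norm (?F z)))"
  note UI = cylinder_sets_lebesgue[OF U, of T]
  have L: "L = real_of_ereal ?E" unfolding L_def Linf_norm_def using meas by simp
  have meas': "(\<lambda>z. ereal (norm (?F z))) \<in> borel_measurable ?M"
    by (rule borel_measurable_ereal[OF measurable_compose[OF meas borel_measurable_norm]])
  have "AE z in ?M. norm (?F z) \<le> B"
    using AE_cylinder[OF U bound, of T] by eventually_elim auto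
  then have le_B: "?E \<le> ereal B"
    by (intro esssup_I meas') auto
  have *: "AE z in ?M. ereal (norm (?F z)) \<le> ?E" by (rule esssup_AE)
  have F_le: "AE z in ?M. ?F z \<le> L"
    using *
  proof eventually_elim
    case (elim z)
    then show ?case using le_B unfolding L by (cases ?E) auto
  qed
  show L0: "0 \<le> L"
  proof (rule ccontr)
    assume neg: "\<not> 0 \<le> L"
    then obtain r where r: "?E = ereal r" "r < 0" using L by (cases ?E) auto
    have "AE z in ?M. False"
      using *
    proof eventually_elim
      case (elim z)
      then show ?case using r norm_ge_zero[of "?F z"] by (simp del: norm_ge_zero real_norm_def)
    qed
    then have "ae_filter ?M = bot" by (simp add: trivial_limit_def)
    then have "?E = - \<infinity>"
      by (intro esssup_zero_space meas') (simp add: ae_filter_eq_bot_iff)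
    then show False using r by simp
  qed
  have "AE z in lebesgue. z \<in> U \<times> ?I \<longrightarrow> ?F z \<le> L"
    using F_le AE_restrict_space_iff[of "U \<times> ?I" lebesgue] UI by simp
  then have "AE z in lborel \<Otimes>\<^sub>M lborel. z \<in> U \<times> ?I \<longrightarrow> ?F z \<le> L"
    unfolding lborel_prod AE_completion_iff .
  then have "AE x in lborel. AE t in lborel. (x, t) \<in> U \<times> ?I \<longrightarrow> ?F (x, t) \<le> L"
    by (rule lborel_pair.AE_pair)
  then have sections: "AE x in lebesgue. AE t in lborel. (x, t) \<in> U \<times> ?I \<longrightarrow> ?F (x, t) \<le> L"
    by (rule AE_completion)
  show "AE x in lebesgue_on U. \<forall>t\<in>?I. F x t \<le> L"
    unfolding AE_lebesgue_on_iff[OF U]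
    using sections cont[unfolded AE_lebesgue_on_iff[OF U]]
  proof eventually_elim
    case (elim x)
    show ?case
    proof (intro impI ballI, rule ccontr)
      fix t assume x: "x \<in> U" and t: "t \<in> ?I" and gt: "\<not> F x t \<le> L"
      have "continuous_on ?I (F x)" using elim x by simp
      then obtain d where d: "0 < d" "\<And>s. s \<in> ?I \<Longrightarrow> dist s t < d \<Longrightarrow> dist (F x s) (F x t) < F x t - L"
        using t gt unfolding continuous_on_iff by (metis diff_gt_0_iff_gt not_le)
      \<comment> \<open>The interval \<open>(a, t)\<close> stays inside the time interval also when \<open>t\<close> is its right end.\<close>
      define a where "a = max 0 (t - d)"
      have a: "a < t" "0 \<le> a" "t - d \<le> a" using t d by (auto simp: a_def)
      have "AE s in lborel. s \<notin> {a<..<t}"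
        using elim(1)
      proof eventually_elim
        case (elim s)
        show ?case
        proof
          assume s: "s \<in> {a<..<t}"
          then have sI: "s \<in> ?I" "dist s t < d" using a t by (auto simp: dist_real_def)
          then have "F x s \<le> L" using elim x by simp
          moreover have "L < F x s" using d(2)[OF sI] by (auto simp: dist_real_def)
          ultimately show False by simp
        qed
      qed
      then have "{a<..<t} \<in> null_sets lborel"
        by (subst (asm) AE_iff_null_sets[symmetric]) auto
      then show False using a by (auto simp: null_sets_def)
    qed
  qed
qed

section \<open>Elliptic matrices and coefficients\<close>

text \<open>The solution of \<open>A y = b\<close> by Cramer's rule. In contrast to \<^const>\<open>matrix_inv\<close>, which is an arbitrary
matrix where \<open>A\<close> is singular, it is a measurable function of the entries, and it is continuous where
the determinant does not vanish.\<close>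

definition cramer_solution :: "real^'n^'n \<Rightarrow> real^'n \<Rightarrow> real^'n::finite" where
  "cramer_solution A b = (\<chi> k. det (\<chi> i j. if j = k then b $ i else A $ i $ j) / det A)"

context
  fixes A :: "real^'n::finite^'n" and \<kappa> :: real
  assumes \<kappa>: "0 < \<kappa>" and elliptic: "\<And>y. \<kappa> * (norm y)\<^sup>2 \<le> y \<bullet> (A *v y)"
begin

lemma elliptic_invertible: "invertible A"
proof -
  have "A *v y = 0 \<longrightarrow> y = 0" for y
    using elliptic[of y] \<kappa> by (auto simp: mult_le_0_iff)
  then show ?thesis
    using matrix_left_invertible_ker[of A] by (auto simp: invertible_left_inverse)
qed

lemma elliptic_det: "det A \<noteq> 0"
  using elliptic_invertible by (simp add: invertible_det_nz)

lemma elliptic_solve: "A *v (matrix_inv A *v b) = b"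
proof -
  have "A ** matrix_inv A = mat 1"
    using elliptic_invertible unfolding invertible_def matrix_inv_def by (rule someI2_ex) simp
  then show ?thesis by (simp add: matrix_vector_mul_assoc)
qed

lemma elliptic_cramer: "matrix_inv A *v b = cramer_solution A b"
  using cramer[OF elliptic_det, of "matrix_inv A *v b" b] elliptic_solve
  by (simp add: cramer_solution_def)

lemma elliptic_inv_norm: "norm (matrix_inv A *v b) \<le> norm b / \<kappa>"
proof (cases "matrix_inv A *v b = 0")
  case False
  let ?z = "matrix_inv A *v b"
  have "\<kappa> * (norm ?z)\<^sup>2 \<le> norm ?z * norm b"
    using elliptic[of ?z] norm_cauchy_schwarz[of ?z b] by (simp add: elliptic_solve)
  then have "norm ?z * (\<kappa> * norm ?z) \<le> norm ?z * norm b" by (simp add: power2_eq_square mult_ac)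
  then have "\<kappa> * norm ?z \<le> norm b" using False by simp
  then show ?thesis using \<kappa> by (simp add: field_simps)
qed (use \<kappa> in auto)

lemma elliptic_inv_form_bounds:
  "0 \<le> b \<bullet> (matrix_inv A *v b)" "b \<bullet> (matrix_inv A *v b) \<le> (norm b)\<^sup>2 / \<kappa>"
proof -
  let ?z = "matrix_inv A *v b"
  have "0 \<le> \<kappa> * (norm ?z)\<^sup>2" using \<kappa> by simp
  also have "\<dots> \<le> ?z \<bullet> b" using elliptic[of ?z] by (simp add: elliptic_solve)
  finally show "0 \<le> b \<bullet> ?z" by (simp add: inner_commute)
  have "b \<bullet> ?z \<le> norm b * norm ?z" by (rule norm_cauchy_schwarz)
  also have "\<dots> \<le> norm b * (norm b / \<kappa>)" by (intro mult_left_mono elliptic_inv_norm) auto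
  finally show "b \<bullet> ?z \<le> (norm b)\<^sup>2 / \<kappa>" by (simp add: power2_eq_square)
qed

text \<open>With \<open>z = A\<^sup>-\<^sup>1 s\<close> and \<open>y = A\<^sup>-\<^sup>1 b\<close>, the right-hand side is the energy \<open>x \<cdot> A x\<close> of \<open>x = z + (r/2) y\<close>.\<close>

lemma elliptic_complete_square:
  assumes sym: "transpose A = A"
  shows "0 \<le> (matrix_inv A *v s) \<bullet> s + r * (b \<bullet> (matrix_inv A *v s))
              + r\<^sup>2 / 4 * (b \<bullet> (matrix_inv A *v b))"
proof -
  let ?z = "matrix_inv A *v s" and ?y = "matrix_inv A *v b"
  let ?x = "?z + (r / 2) *\<^sub>R ?y"
  have "0 \<le> \<kappa> * (norm ?x)\<^sup>2" using \<kappa> by simp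
  also have "\<dots> \<le> ?x \<bullet> (A *v ?x)" by (rule elliptic)
  also have "A *v ?x = s + (r / 2) *\<^sub>R b"
    by (simp add: matrix_vector_right_distrib matrix_vector_mult_scaleR elliptic_solve)
  also have "?x \<bullet> (s + (r / 2) *\<^sub>R b) =
      ?z \<bullet> s + r / 2 * (?z \<bullet> b) + r / 2 * (?y \<bullet> s) + r\<^sup>2 / 4 * (?y \<bullet> b)"
    by (simp add: inner_add_left inner_add_right algebra_simps power2_eq_square)
  also have "?y \<bullet> s = ?z \<bullet> b"
  proof -
    have "?y \<bullet> s = ?y \<bullet> (A *v ?z)" by (simp add: elliptic_solve)
    also have "\<dots> = (A *v ?y) \<bullet> ?z"
      using dot_lmul_matrix[of ?y A ?z] sym transpose_matrix_vector[of A ?y] by simp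
    finally show ?thesis by (simp add: elliptic_solve inner_commute)
  qed
  finally show ?thesis by (simp add: inner_commute algebra_simps)
qed

end

lemma cramer_solution_measurable:
  fixes A :: "'a \<Rightarrow> real^'n::finite^'n"
  assumes A: "\<And>i j. (\<lambda>x. A x $ i $ j) \<in> borel_measurable M"
    and b: "\<And>i. (\<lambda>x. b x $ i) \<in> borel_measurable M"
  shows "(\<lambda>x. cramer_solution (A x) (b x)) \<in> borel_measurable M"
proof -
  have d: "(\<lambda>x. det (B x)) \<in> borel_measurable M"
    if "\<And>i j. (\<lambda>x. B x $ i $ j) \<in> borel_measurable M" for B :: "'a \<Rightarrow> real^'n^'n"
    unfolding det_def using that
    by (intro borel_measurable_sum borel_measurable_times borel_measurable_prod borel_measurable_const)
  have "(\<lambda>x. cramer_solution (A x) (b x) $ k) \<in> borel_measurable M" for k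
    unfolding cramer_solution_def vec_lambda_beta
  proof (intro borel_measurable_divide d A)
    fix i j
    show "(\<lambda>x. (\<chi> i j. if j = k then b x $ i else A x $ i $ j) $ i $ j) \<in> borel_measurable M"
      using A b by (cases "j = k") auto
  qed
  then show ?thesis
    by (subst borel_measurable_euclidean_space) (auto simp: Basis_vec_def inner_axis)
qed

lemma cramer_solution_continuous_on:
  fixes A :: "'a::topological_space \<Rightarrow> real^'n::finite^'n"
  assumes A: "continuous_on S A" and b: "continuous_on S b" and "\<And>x. x \<in> S \<Longrightarrow> det (A x) \<noteq> 0"
  shows "continuous_on S (\<lambda>x. cramer_solution (A x) (b x))"
proof -
  have d: "continuous_on S (\<lambda>x. det (B x))"
    if "\<And>i j. continuous_on S (\<lambda>x. B x $ i $ j)" for B :: "'a \<Rightarrow> real^'n^'n"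
    unfolding det_def using that
    by (intro continuous_on_sum continuous_on_mult continuous_on_prod continuous_on_const)
  show ?thesis
    unfolding cramer_solution_def
  proof (intro continuous_on_vec_lambda continuous_on_divide d ballI assms(3))
    fix k i j
    show "continuous_on S (\<lambda>x. (\<chi> i j. if j = k then b x $ i else A x $ i $ j) $ i $ j)"
      using A b by (cases "j = k") (auto intro!: continuous_intros)
  qed (auto intro!: continuous_intros A)
qed

lemma closed_elliptic: "closed {A :: real^'n::finite^'n. \<forall>y. \<kappa> * (norm y)\<^sup>2 \<le> y \<bullet> (A *v y)}"
  unfolding inner_vec_def matrix_vector_mult_def vec_lambda_beta inner_real_def
  by (intro closed_Collect_all closed_Collect_le continuous_intros)

lemma bounded_coeffD:
  fixes F :: "'a::euclidean_space \<Rightarrow> real \<Rightarrow> 'b::euclidean_space"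
  assumes "bounded_coeff U T C F"
  shows "AE x in lebesgue_on U. continuous_on {0<..T} (F x)"
    and "t \<in> {0<..T} \<Longrightarrow> (\<lambda>x. F x t) \<in> borel_measurable (lebesgue_on U)"
    and "AE x in lebesgue_on U. \<forall>t\<in>{0<..T}. norm (F x t) \<le> C"
proof -
  obtain D where D: "time_derivs U T F D"
    and le: "\<And>k t. k \<le> 3 \<Longrightarrow> t \<in> {0<..T} \<Longrightarrow> Linf_norm (lebesgue_on U) (\<lambda>x. D k x t) \<le> ereal C"
    using assms unfolding bounded_coeff_def by blast
  have D0: "D 0 = F" using D by (simp add: time_derivs_def)
  have "AE x in lebesgue_on U. \<forall>t\<in>{0<..T}. (D 0 x has_vector_derivative D (Suc 0) x t) (at t within {0<..T})"
    using D unfolding time_derivs_def by (meson zero_less_numeral)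
  then show cont: "AE x in lebesgue_on U. continuous_on {0<..T} (F x)"
    by eventually_elim
       (auto simp: D0 continuous_on_eq_continuous_within intro: has_vector_derivative_continuous)
  have L: "Linf_norm (lebesgue_on U) (\<lambda>x. F x t) \<le> ereal C" if "t \<in> {0<..T}" for t
    using le[of 0 t] that D0 by simp
  show meas: "(\<lambda>x. F x t) \<in> borel_measurable (lebesgue_on U)" if "t \<in> {0<..T}" for t
    using L[OF that] by (auto simp: Linf_norm_def split: if_splits)
  have "AE x in lebesgue_on U. F x t \<in> cball 0 C" if t: "t \<in> {0<..T}" for t
  proof -
    have "esssup (lebesgue_on U) (\<lambda>x. ereal (norm (F x t))) \<le> ereal C"
      using L[OF t] meas[OF t] by (simp add: Linf_norm_def)
    moreover have "AE x in lebesgue_on U. ereal (norm (F x t))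
        \<le> esssup (lebesgue_on U) (\<lambda>x. ereal (norm (F x t)))"
      by (rule esssup_AE)
    ultimately show ?thesis
      by (auto elim!: eventually_mono dest: order_trans)
  qed
  from AE_all_times[OF closed_cball this cont]
  show "AE x in lebesgue_on U. \<forall>t\<in>{0<..T}. norm (F x t) \<le> C" by simp
qed

lemma diffusion_matrixD:
  fixes A :: "real^'n::finite \<Rightarrow> real \<Rightarrow> real^'n^'n"
  assumes "diffusion_matrix U T \<kappa>0 \<kappa>1 C A"
  shows "AE x in lebesgue_on U. continuous_on {0<..T} (A x)"
    and "AE x in lebesgue_on U. \<forall>t\<in>{0<..T}. \<forall>y. \<kappa>0 * (norm y)\<^sup>2 \<le> y \<bullet> (A x t *v y)"
    and "t \<in> {0<..T} \<Longrightarrow> AE x in lebesgue_on U. transpose (A x t) = A x t"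
    and "t \<in> {0<..T} \<Longrightarrow> (\<lambda>x. A x t $ i $ j) \<in> borel_measurable (lebesgue_on U)"
proof -
  have "AE x in lebesgue_on U. continuous_on {0..T} (A x)"
    using assms by (simp add: diffusion_matrix_def)
  then show cont: "AE x in lebesgue_on U. continuous_on {0<..T} (A x)"
    by eventually_elim (auto elim: continuous_on_subset)
  have pt: "AE x in lebesgue_on U. transpose (A x t) = A x t \<and>
        (\<forall>y. \<kappa>0 * (norm y)\<^sup>2 \<le> y \<bullet> (A x t *v y) \<and> y \<bullet> (A x t *v y) \<le> \<kappa>1 * (norm y)\<^sup>2)"
    if "t \<in> {0<..T}" for t
    using assms that by (simp add: diffusion_matrix_def)
  have "AE x in lebesgue_on U. A x t \<in> {A. \<forall>y. \<kappa>0 * (norm y)\<^sup>2 \<le> y \<bullet> (A *v y)}"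
    if "t \<in> {0<..T}" for t
    using pt[OF that] by eventually_elim simp
  from AE_all_times[OF closed_elliptic this cont]
  show "AE x in lebesgue_on U. \<forall>t\<in>{0<..T}. \<forall>y. \<kappa>0 * (norm y)\<^sup>2 \<le> y \<bullet> (A x t *v y)" by simp
  show "AE x in lebesgue_on U. transpose (A x t) = A x t" if "t \<in> {0<..T}"
    using pt[OF that] by eventually_elim simp
  obtain D where D: "time_derivs U T A D"
    and le: "\<And>k t i j. k \<le> 3 \<Longrightarrow> t \<in> {0<..T} \<Longrightarrow> W1inf_le U C (\<lambda>x. D k x t $ i $ j)"
    using assms unfolding diffusion_matrix_def by blast
  have D0: "D 0 = A" using D by (simp add: time_derivs_def)
  show "(\<lambda>x. A x t $ i $ j) \<in> borel_measurable (lebesgue_on U)" if "t \<in> {0<..T}"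
    using le[of 0 t i j] that unfolding W1inf_le_def D0
    by (auto simp: Linf_norm_def split: if_splits)
qed

text \<open>The quadratic form agrees almost everywhere with its expression by Cramer's rule, which provides
measurability on the cylinder and continuity in time; ellipticity bounds it by \<open>C\<^sub>b\<^sup>2 / \<kappa>\<^sub>0\<close>.\<close>

lemma convection_form_time_slice:
  fixes A :: "real^'n::finite \<Rightarrow> real \<Rightarrow> real^'n^'n"
  assumes U: "open U" and \<kappa>0: "0 < \<kappa>0"
    and A: "diffusion_matrix U T \<kappa>0 \<kappa>1 CA A" and b: "bounded_coeff U T Cb b"
  defines "L \<equiv> real_of_ereal (Linf_norm (lebesgue_on (U \<times> {0<..T}))
               (\<lambda>(x, t). b x t \<bullet> (matrix_inv (A x t) *v b x t)))"
  shows "AE x in lebesgue_on U. \<forall>t\<in>{0<..T}. b x t \<bullet> (matrix_inv (A x t) *v b x t) \<le> L"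
    and "0 \<le> L"
proof -
  let ?I = "{0<..T}"
  let ?F = "\<lambda>x t. b x t \<bullet> (matrix_inv (A x t) *v b x t)"
  let ?G = "\<lambda>x t. b x t \<bullet> cramer_solution (A x t) (b x t)"
  note AD = diffusion_matrixD[OF A] and mA = A[unfolded diffusion_matrix_def, THEN conjunct1]
  note B = bounded_coeffD[OF b] and mb = b[unfolded bounded_coeff_def, THEN conjunct1]
  have FG: "AE x in lebesgue_on U. \<forall>t\<in>?I. ?F x t = ?G x t"
    using AD(2)
  proof eventually_elim
    case (elim x)
    show ?case
    proof
      fix t assume "t \<in> ?I"
      then have "\<And>y. \<kappa>0 * (norm y)\<^sup>2 \<le> y \<bullet> (A x t *v y)" using elim by simp
      then show "?F x t = ?G x t" by (simp only: elliptic_cramer[OF \<kappa>0])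
    qed
  qed
  note UI = cylinder_sets_lebesgue[OF U, of T]
  have "(\<lambda>(x, t). ?G x t) \<in> borel_measurable (lebesgue_on (U \<times> ?I))"
  proof -
    have 1: "(\<lambda>z. (case z of (x, t) \<Rightarrow> A x t) $ i $ j) \<in> borel_measurable (lebesgue_on (U \<times> ?I))" for i j
      by (rule borel_measurable_continuous_on[OF _ mA, of "\<lambda>M. M $ i $ j"]) (intro continuous_intros)
    have 2: "(\<lambda>z. (case z of (x, t) \<Rightarrow> b x t) $ i) \<in> borel_measurable (lebesgue_on (U \<times> ?I))" for i
      by (rule borel_measurable_continuous_on[OF _ mb, of "\<lambda>M. M $ i"]) (intro continuous_intros)
    show ?thesis
      using borel_measurable_inner[OF mb cramer_solution_measurable[OF 1 2]]
      by (simp add: case_prod_beta)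
  qed
  moreover have "AE z in lebesgue_on (U \<times> ?I). (\<lambda>(x, t). ?G x t) z = (\<lambda>(x, t). ?F x t) z"
    using AE_cylinder[OF U FG, of T] by eventually_elim auto
  ultimately have meas: "(\<lambda>(x, t). ?F x t) \<in> borel_measurable (lebesgue_on (U \<times> ?I))"
    by (rule borel_measurable_lebesgue_on_AE[OF UI])
  have cont: "AE x in lebesgue_on U. continuous_on ?I (?F x)"
    using AD(1,2) B(1) FG
  proof eventually_elim
    case (elim x)
    have "det (A x t) \<noteq> 0" if "t \<in> ?I" for t
      by (rule elliptic_det[OF \<kappa>0]) (use elim(2) that in blast)
    then have "continuous_on ?I (?G x)"
      using elim by (intro continuous_on_inner cramer_solution_continuous_on) auto
    then show ?case using elim(4) by (subst continuous_on_cong) auto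
  qed
  have bound: "AE x in lebesgue_on U. \<forall>t\<in>?I. 0 \<le> ?F x t \<and> ?F x t \<le> Cb\<^sup>2 / \<kappa>0"
    using AD(2) B(3)
  proof eventually_elim
    case (elim x)
    show ?case
    proof
      fix t assume t: "t \<in> ?I"
      have e: "\<And>y. \<kappa>0 * (norm y)\<^sup>2 \<le> y \<bullet> (A x t *v y)" using elim(1) t by blast
      have "(norm (b x t))\<^sup>2 \<le> Cb\<^sup>2" using elim(2) t by (intro power_mono) auto
      then have "(norm (b x t))\<^sup>2 / \<kappa>0 \<le> Cb\<^sup>2 / \<kappa>0" using \<kappa>0 by (intro divide_right_mono) auto
      then show "0 \<le> ?F x t \<and> ?F x t \<le> Cb\<^sup>2 / \<kappa>0"
        using elliptic_inv_form_bounds[OF \<kappa>0 e, of "b x t"] by linarith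
    qed
  qed
  show "AE x in lebesgue_on U. \<forall>t\<in>?I. ?F x t \<le> L" "0 \<le> L"
    unfolding L_def by (rule Linf_time_slice[OF U meas cont bound])+
qed

lemma reaction_time_slice:
  fixes c :: "'a::euclidean_space \<Rightarrow> real \<Rightarrow> real"
  assumes U: "open U" and c: "bounded_coeff U T Cc c"
  defines "L \<equiv> real_of_ereal (Linf_norm (lebesgue_on (U \<times> {0<..T})) (\<lambda>(x, t). max 0 (- c x t)))"
  shows "AE x in lebesgue_on U. \<forall>t\<in>{0<..T}. - c x t \<le> L" and "0 \<le> L"
proof -
  note C = bounded_coeffD[OF c] and mc = c[unfolded bounded_coeff_def, THEN conjunct1]
  have meas: "(\<lambda>(x, t). max 0 (- c x t)) \<in> borel_measurable (lebesgue_on (U \<times> {0<..T}))"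
  proof -
    have "(\<lambda>z. max 0 (- (case z of (x, t) \<Rightarrow> c x t))) \<in> borel_measurable (lebesgue_on (U \<times> {0<..T}))"
      by (rule borel_measurable_max[OF borel_measurable_uminus[OF mc] borel_measurable_const])
    also have "(\<lambda>z. max 0 (- (case z of (x, t) \<Rightarrow> c x t))) = (\<lambda>(x, t). max 0 (- c x t))"
      by auto
    finally show ?thesis .
  qed
  have cont: "AE x in lebesgue_on U. continuous_on {0<..T} (\<lambda>t. max 0 (- c x t))"
    using C(1) by eventually_elim (intro continuous_intros)
  have bound: "AE x in lebesgue_on U. \<forall>t\<in>{0<..T}. 0 \<le> max 0 (- c x t) \<and> max 0 (- c x t) \<le> \<bar>Cc\<bar>"
    using C(3) by eventually_elim (auto simp: abs_le_iff)
  note * = Linf_time_slice[OF U meas cont bound]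
  show "0 \<le> L" unfolding L_def by (rule *(2))
  show "AE x in lebesgue_on U. \<forall>t\<in>{0<..T}. - c x t \<le> L"
    unfolding L_def using *(1) by eventually_elim auto
qed

section \<open>The energy inequality of the scheme\<close>

lemma Hdiv_L2: "w \<in> Hdiv U \<Longrightarrow> w \<in> L2 U"
  by (simp add: Hdiv_def)

lemma wdiv_L2:
  assumes "w \<in> Hdiv U"
  shows "wdiv U w \<in> L2 U"
proof -
  have "\<exists>q. q \<in> L2 U \<and> has_weak_div U w q" using assms by (auto simp: Hdiv_def)
  then show ?thesis unfolding wdiv_def by (rule someI2_ex) simp
qed

lemma extrapol_L2:
  assumes "\<And>j. j < n \<Longrightarrow> (\<lambda>x. u j x) \<in> L2 U" "1 \<le> n" "1 \<le> m"
  shows "(\<lambda>x. extrapol t m n (\<lambda>j. u j x)) \<in> L2 U"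
  unfolding extrapol_def using assms by (cases "n \<le> m") (auto intro!: L2_diff L2_cmult)

lemma L2_matrix_inv:
  fixes A :: "real^'n::finite \<Rightarrow> real \<Rightarrow> real^'n^'n"
  assumes U: "open U" and \<kappa>0: "0 < \<kappa>0" and A: "diffusion_matrix U T \<kappa>0 \<kappa>1 CA A"
    and t: "t \<in> {0<..T}" and s: "s \<in> L2 U"
  shows "(\<lambda>x. matrix_inv (A x t) *v s x) \<in> L2 U"
proof (rule L2_bounded[OF _ s])
  note AD = diffusion_matrixD[OF A]
  have S: "(\<lambda>x. s x $ i) \<in> borel_measurable (lebesgue_on U)" for i
    by (rule borel_measurable_continuous_on[OF _ L2_measurable[OF s], of "\<lambda>v. v $ i"])
       (intro continuous_intros)
  have eq: "AE x in lebesgue_on U. cramer_solution (A x t) (s x) = matrix_inv (A x t) *v s x"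
    using AD(2)
  proof eventually_elim
    case (elim x)
    then have "\<And>y. \<kappa>0 * (norm y)\<^sup>2 \<le> y \<bullet> (A x t *v y)" using t by blast
    then show ?case by (simp only: elliptic_cramer[OF \<kappa>0])
  qed
  show "(\<lambda>x. matrix_inv (A x t) *v s x) \<in> borel_measurable (lebesgue_on U)"
    by (rule borel_measurable_lebesgue_on_AE[OF _ cramer_solution_measurable[OF AD(4)[OF t] S] eq])
       (use U in auto)
  show "AE x in lebesgue_on U. norm (matrix_inv (A x t) *v s x) \<le> (1 / \<kappa>0) * norm (s x)"
    using AD(2)
  proof eventually_elim
    case (elim x)
    then have "\<And>y. \<kappa>0 * (norm y)\<^sup>2 \<le> y \<bullet> (A x t *v y)" using t by blast
    then show ?case using elliptic_inv_norm[OF \<kappa>0, of "A x t" "s x"] by simp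
  qed
qed

lemma l2norm_diff_sq_le:
  fixes f g :: "'a::euclidean_space \<Rightarrow> real"
  assumes "f \<in> L2 U" "g \<in> L2 U"
  shows "(l2norm U (\<lambda>x. a * f x - b * g x))\<^sup>2 \<le> 2 * (a\<^sup>2 * (l2norm U f)\<^sup>2 + b\<^sup>2 * (l2norm U g)\<^sup>2)"
proof -
  have sc: "(l2norm U (\<lambda>x. r * h x))\<^sup>2 = r\<^sup>2 * (l2norm U h)\<^sup>2" for r and h :: "'a \<Rightarrow> real"
    using l2norm_scaleR_sq[of U r h] by simp
  have ex: "(l2norm U (\<lambda>x. a * f x - r * g x))\<^sup>2
      = a\<^sup>2 * (l2norm U f)\<^sup>2 - 2 * (a * (r * l2ip U f g)) + r\<^sup>2 * (l2norm U g)\<^sup>2" for r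
    using l2norm_diff_sq[OF L2_cmult[OF assms(1), of a] L2_cmult[OF assms(2), of r]]
    by (simp add: sc l2ip_cmult_left l2ip_commute[of U f "\<lambda>x. r * g x"] l2ip_commute[of U g f])
  have "0 \<le> (l2norm U (\<lambda>x. a * f x - (- b) * g x))\<^sup>2" by simp
  then show ?thesis unfolding ex by simp
qed

text \<open>The two tests of the scheme give
\<open>(D u, u) = - (z, \<sigma>) - (b \<cdot> z, u) - (c u, u) + lam (I E u, u) + (E f, u)\<close> with \<open>z = A\<^sup>-\<^sup>1 \<sigma>\<close>. The first two terms
are bounded by completing the square pointwise, the third by the negative part of \<open>c\<close>, the fourth
by Young's inequality with weight \<open>\<epsilon>\<close> and the last one by the Cauchy-Schwarz inequality.\<close>

lemma imex_energy_inequality: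
  fixes A :: "real^'n::finite \<Rightarrow> real \<Rightarrow> real^'n^'n"
  assumes mesh: "L1_mesh \<alpha> t" and U: "open U" and \<kappa>0: "0 < \<kappa>0"
    and A: "diffusion_matrix U T \<kappa>0 \<kappa>1 CA A"
    and b: "bounded_coeff U T Cb b" and c: "bounded_coeff U T Cc c"
    and g: "bounded_int_op U CI g"
    and V: "V \<subseteq> L2 U" and W: "W \<subseteq> Hdiv U"
    and scheme: "imex_L1_mixed_fem U \<alpha> t N A b c lam g f u0 V W u \<sigma>"
    and n: "1 \<le> n" "n \<le> N" and tn: "t n \<in> {0<..T}" and start: "1 \<le> n_start \<alpha> N"
    and f: "\<And>j. j \<le> n \<Longrightarrow> (\<lambda>x. f x (t j)) \<in> L2 U"
    and \<epsilon>: "0 < \<epsilon>"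
  shows "L1_deriv \<alpha> t n (\<lambda>j. (l2norm U (u j))\<^sup>2) \<le>
       lambda_S U T A b c \<epsilon> lam * (l2norm U (u n))\<^sup>2
       + 1 / \<epsilon> * \<bar>lam\<bar> * CI\<^sup>2 * (l2norm U (\<lambda>x. extrapol t (n_start \<alpha> N) n (\<lambda>j. u j x)))\<^sup>2
       + 2 * l2norm U (\<lambda>x. extrapol t (n_start \<alpha> N) n (\<lambda>k. f x (t k))) * l2norm U (u n)"
proof -
  interpret L1_mesh \<alpha> t by (rule mesh)
  let ?m = "n_start \<alpha> N"
  let ?z = "\<lambda>x. matrix_inv (A x (t n)) *v \<sigma> n x"
  let ?bz = "\<lambda>x. b x (t n) \<bullet> ?z x" and ?cu = "\<lambda>x. c x (t n) * u n x"
  let ?Eu = "\<lambda>x. extrapol t ?m n (\<lambda>j. u j x)" and ?Ef = "\<lambda>x. extrapol t ?m n (\<lambda>k. f x (t k))"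
  let ?I = "int_op U g ?Eu"
  define lb where "lb = real_of_ereal (Linf_norm (lebesgue_on (U \<times> {0<..T}))
               (\<lambda>(x, t). b x t \<bullet> (matrix_inv (A x t) *v b x t)))"
  define lc where "lc = real_of_ereal (Linf_norm (lebesgue_on (U \<times> {0<..T})) (\<lambda>(x, t). max 0 (- c x t)))"
  have uV: "u j \<in> L2 U" if "j \<le> n" for j
    using scheme that n V unfolding imex_L1_mixed_fem_def by (meson order_trans subsetD)
  have u: "u n \<in> L2 U" by (simp add: uV)
  have sW: "\<sigma> n \<in> W" and unV: "u n \<in> V"
    using scheme n unfolding imex_L1_mixed_fem_def by auto
  then have "\<sigma> n \<in> Hdiv U" using W by auto
  then have s: "\<sigma> n \<in> L2 U" "wdiv U (\<sigma> n) \<in> L2 U" by (rule Hdiv_L2, rule wdiv_L2)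
  have z: "?z \<in> L2 U" by (rule L2_matrix_inv[OF U \<kappa>0 A tn s(1)])
  note AD = diffusion_matrixD[OF A] and bD = bounded_coeffD[OF b] and cD = bounded_coeffD[OF c]
  have bz: "?bz \<in> L2 U"
  proof (rule L2_bounded[OF _ z])
    show "?bz \<in> borel_measurable (lebesgue_on U)"
      by (intro borel_measurable_inner bD(2)[OF tn] L2_measurable[OF z])
    show "AE x in lebesgue_on U. norm (?bz x) \<le> Cb * norm (?z x)"
      using bD(3)
    proof eventually_elim
      case (elim x)
      have "\<bar>?bz x\<bar> \<le> norm (b x (t n)) * norm (?z x)" by (rule Cauchy_Schwarz_ineq2)
      also have "\<dots> \<le> Cb * norm (?z x)" using elim tn by (intro mult_right_mono) auto
      finally show ?case by simp
    qed
  qed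
  have cu: "?cu \<in> L2 U"
  proof (rule L2_bounded[OF _ u])
    show "?cu \<in> borel_measurable (lebesgue_on U)"
      by (intro borel_measurable_times cD(2)[OF tn] L2_measurable[OF u])
    show "AE x in lebesgue_on U. norm (?cu x) \<le> Cc * norm (u n x)"
      using cD(3)
      by eventually_elim (use tn in \<open>auto simp: abs_mult intro!: mult_right_mono\<close>)
  qed
  have Eu: "?Eu \<in> L2 U" by (rule extrapol_L2) (use uV n start in auto)
  have Ef: "?Ef \<in> L2 U" by (rule extrapol_L2) (use f n start in auto)
  have I: "?I \<in> L2 U" and I_le: "l2norm U ?I \<le> CI * l2norm U ?Eu"
    using g Eu unfolding bounded_int_op_def by blast+
  have test_\<sigma>: "l2ip U ?z (\<sigma> n) + l2ip U (u n) (wdiv U (\<sigma> n)) = 0"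
    using scheme sW n unfolding imex_L1_mixed_fem_def by blast
  have test_u: "l2ip U (\<lambda>x. D n (\<lambda>j. u j x)) (u n) - l2ip U (wdiv U (\<sigma> n)) (u n)
        + l2ip U ?bz (u n) + l2ip U ?cu (u n) = lam * l2ip U ?I (u n) + l2ip U ?Ef (u n)"
    using scheme unV n unfolding imex_L1_mixed_fem_def by auto
  have convection: "0 \<le> l2ip U ?z (\<sigma> n) + l2ip U ?bz (u n) + lb / 4 * (l2norm U (u n))\<^sup>2"
  proof -
    have "AE x in lebesgue_on U. 0 \<le> ?z x \<bullet> \<sigma> n x + ?bz x * u n x + lb / 4 * (u n x * u n x)"
      using AD(2) AD(3)[OF tn] convection_form_time_slice(1)[OF U \<kappa>0 A b, folded lb_def]
    proof eventually_elim
      case (elim x)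
      have e: "\<And>y. \<kappa>0 * (norm y)\<^sup>2 \<le> y \<bullet> (A x (t n) *v y)" using elim(1) tn by blast
      \<comment> \<open>The square is completed with the weight \<open>r = u\<^sub>n(x)\<close>.\<close>
      have "(u n x)\<^sup>2 / 4 * (b x (t n) \<bullet> (matrix_inv (A x (t n)) *v b x (t n))) \<le> (u n x)\<^sup>2 / 4 * lb"
        using elim(3) tn by (intro mult_left_mono) auto
      with elliptic_complete_square[OF \<kappa>0 e elim(2), of "\<sigma> n x" "u n x" "b x (t n)"]
      show ?case by (simp add: power2_eq_square algebra_simps)
    qed
    then have "0 \<le> (\<integral>x. ?z x \<bullet> \<sigma> n x + ?bz x * u n x + lb / 4 * (u n x * u n x) \<partial>lebesgue_on U)"
      by (rule integral_nonneg_AE)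
    also have "\<dots> = l2ip U ?z (\<sigma> n) + l2ip U ?bz (u n) + lb / 4 * l2ip U (u n) (u n)"
      using L2_integrable_inner[OF z s(1)] L2_integrable_inner[OF bz u] L2_integrable_inner[OF u u]
      by (simp add: l2ip_def)
    finally show ?thesis by (simp add: l2norm_sq)
  qed
  have reaction: "- (lc * (l2norm U (u n))\<^sup>2) \<le> l2ip U ?cu (u n)"
  proof -
    have "l2ip U (\<lambda>x. - lc * u n x) (u n) \<le> l2ip U ?cu (u n)"
    proof (rule l2ip_mono[OF L2_cmult[OF u] u cu u])
      show "AE x in lebesgue_on U. (- lc * u n x) \<bullet> u n x \<le> ?cu x \<bullet> u n x"
        using reaction_time_slice(1)[OF U c, folded lc_def]
      proof eventually_elim
        case (elim x)
        have "- lc * (u n x * u n x) \<le> c x (t n) * (u n x * u n x)"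
          using elim tn by (intro mult_right_mono) (auto simp: minus_le_iff)
        then show ?case by (simp add: mult.assoc)
      qed
    qed
    then show ?thesis unfolding l2ip_cmult_left by (simp add: l2norm_sq)
  qed
  have nonlocal: "2 * (lam * l2ip U ?I (u n))
      \<le> \<epsilon> * \<bar>lam\<bar> * (l2norm U (u n))\<^sup>2 + 1 / \<epsilon> * \<bar>lam\<bar> * CI\<^sup>2 * (l2norm U ?Eu)\<^sup>2"
  proof -
    have "(l2norm U ?I)\<^sup>2 \<le> (CI * l2norm U ?Eu)\<^sup>2"
      using I_le l2norm_nonneg by (intro power_mono)
    then have "\<epsilon> * (l2norm U (u n))\<^sup>2 + 1 / \<epsilon> * (l2norm U ?I)\<^sup>2 \<le>
        \<epsilon> * (l2norm U (u n))\<^sup>2 + 1 / \<epsilon> * (CI\<^sup>2 * (l2norm U ?Eu)\<^sup>2)" (is "?Y \<le> ?Z")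
      using \<epsilon> by (intro add_left_mono mult_left_mono) (auto simp: power_mult_distrib)
    moreover have "2 * l2ip U ?I (u n) \<le> ?Y"
      using l2ip_Young[OF u I \<epsilon>] by (simp add: l2ip_commute)
    moreover have "- (2 * l2ip U ?I (u n)) \<le> ?Y"
    proof -
      have "2 * l2ip U (u n) (\<lambda>x. (- 1) * ?I x)
          \<le> \<epsilon> * (l2norm U (u n))\<^sup>2 + 1 / \<epsilon> * (l2norm U (\<lambda>x. (- 1) * ?I x))\<^sup>2"
        by (rule l2ip_Young[OF u L2_cmult[OF I] \<epsilon>])
      moreover have "(l2norm U (\<lambda>x. (- 1) * ?I x))\<^sup>2 = (l2norm U ?I)\<^sup>2"
        using l2norm_scaleR_sq[of U "-1" ?I] by simp
      moreover have "l2ip U (u n) (\<lambda>x. (- 1) * ?I x) = - l2ip U ?I (u n)"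
        using l2ip_cmult_left[of U "-1" ?I "u n"] by (simp add: l2ip_commute)
      ultimately show ?thesis by simp
    qed
    ultimately have "\<bar>2 * l2ip U ?I (u n)\<bar> \<le> ?Z" by linarith
    then have "\<bar>lam\<bar> * \<bar>2 * l2ip U ?I (u n)\<bar> \<le> \<bar>lam\<bar> * ?Z" by (rule mult_left_mono) simp
    moreover have "2 * (lam * l2ip U ?I (u n)) \<le> \<bar>lam\<bar> * \<bar>2 * l2ip U ?I (u n)\<bar>"
      using abs_ge_self[of "lam * (2 * l2ip U ?I (u n))"] by (simp add: abs_mult)
    ultimately show ?thesis by (simp add: algebra_simps)
  qed
  have "D n (\<lambda>j. (l2norm U (u j))\<^sup>2) \<le> 2 * l2ip U (\<lambda>x. D n (\<lambda>j. u j x)) (u n)"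
    by (rule L1_deriv_energy) (use uV n in auto)
  also have "l2ip U (\<lambda>x. D n (\<lambda>j. u j x)) (u n) = - l2ip U ?z (\<sigma> n) - l2ip U ?bz (u n)
      - l2ip U ?cu (u n) + lam * l2ip U ?I (u n) + l2ip U ?Ef (u n)"
    using test_u test_\<sigma> l2ip_commute[of U "u n" "wdiv U (\<sigma> n)"] by simp
  finally have "D n (\<lambda>j. (l2norm U (u j))\<^sup>2) \<le> 2 * (lb / 4 * (l2norm U (u n))\<^sup>2)
      + 2 * (lc * (l2norm U (u n))\<^sup>2) + 2 * (lam * l2ip U ?I (u n))
      + 2 * (l2norm U ?Ef * l2norm U (u n))"
    using convection reaction l2ip_Cauchy_Schwarz[OF Ef u] unfolding distrib_left right_diff_distrib
    by linarith
  also have "\<dots> \<le> 2 * (lb / 4 * (l2norm U (u n))\<^sup>2) + 2 * (lc * (l2norm U (u n))\<^sup>2)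
      + (\<epsilon> * \<bar>lam\<bar> * (l2norm U (u n))\<^sup>2 + 1 / \<epsilon> * \<bar>lam\<bar> * CI\<^sup>2 * (l2norm U ?Eu)\<^sup>2)
      + 2 * (l2norm U ?Ef * l2norm U (u n))"
    using nonlocal by linarith
  finally show ?thesis
    by (simp add: lambda_S_def lb_def[symmetric] lc_def[symmetric] algebra_simps)
qed

text \<open>One pair of weights serves all steps: those of the linear extrapolation with the largest step ratio
also dominate the constant extrapolation of the initial steps.\<close>

lemma l2norm_extrapol_sq:
  assumes u: "\<And>j. j < n \<Longrightarrow> u j \<in> L2 U" and n: "1 \<le> n" and m: "1 \<le> m"
    and r: "0 \<le> r" and ratio: "m < n \<Longrightarrow> 0 \<le> step_ratio t n \<and> step_ratio t n \<le> r"
  shows "(l2norm U (\<lambda>x. extrapol t m n (\<lambda>j. u j x)))\<^sup>2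
     \<le> 2 * ((1 + r)\<^sup>2 * (l2norm U (u (n - 1)))\<^sup>2 + r\<^sup>2 * (l2norm U (u (n - 2)))\<^sup>2)"
proof (cases "n \<le> m")
  case True
  have "1 \<le> (1 + r)\<^sup>2" using r by (simp add: one_le_power)
  then have "1 * (l2norm U (u (n - 1)))\<^sup>2 \<le> (2 * (1 + r)\<^sup>2) * (l2norm U (u (n - 1)))\<^sup>2"
    by (intro mult_right_mono) auto
  moreover have "0 \<le> r\<^sup>2 * (l2norm U (u (n - 2)))\<^sup>2" by simp
  ultimately have "(l2norm U (u (n - 1)))\<^sup>2
     \<le> 2 * ((1 + r)\<^sup>2 * (l2norm U (u (n - 1)))\<^sup>2 + r\<^sup>2 * (l2norm U (u (n - 2)))\<^sup>2)"
    unfolding distrib_left by linarith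
  then show ?thesis using True by (simp add: extrapol_def)
next
  case False
  let ?s = "step_ratio t n"
  have s: "0 \<le> ?s" "?s \<le> r" using ratio False by auto
  have "(l2norm U (\<lambda>x. extrapol t m n (\<lambda>j. u j x)))\<^sup>2
      = (l2norm U (\<lambda>x. (1 + ?s) * u (n - 1) x - ?s * u (n - 2) x))\<^sup>2"
    using False by (simp add: extrapol_def)
  also have "\<dots> \<le> 2 * ((1 + ?s)\<^sup>2 * (l2norm U (u (n - 1)))\<^sup>2 + ?s\<^sup>2 * (l2norm U (u (n - 2)))\<^sup>2)"
    by (rule l2norm_diff_sq_le) (use u n m False in auto)
  also have "\<dots> \<le> 2 * ((1 + r)\<^sup>2 * (l2norm U (u (n - 1)))\<^sup>2 + r\<^sup>2 * (l2norm U (u (n - 2)))\<^sup>2)"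
    using s by (intro mult_left_mono add_mono mult_right_mono power_mono) auto
  finally show ?thesis .
qed

section \<open>Stability\<close>

theorem theorem3p1:
  fixes \<Omega> :: "(real^'n::finite) set"
    and \<alpha> T lam \<kappa>0 \<kappa>1 CA Cb Cc CI \<gamma> \<epsilon> \<delta> h :: real
    and A :: "real^'n \<Rightarrow> real \<Rightarrow> real^'n^'n"
    and b :: "real^'n \<Rightarrow> real \<Rightarrow> real^'n"
    and c f :: "real^'n \<Rightarrow> real \<Rightarrow> real"
    and g :: "real^'n \<Rightarrow> real^'n \<Rightarrow> real"
    and u0 :: "real^'n \<Rightarrow> real"
    and H :: "real set"
    and \<T> :: "real \<Rightarrow> (real^'n) set set"
    and V :: "real \<Rightarrow> (real^'n \<Rightarrow> real) set"
    and W :: "real \<Rightarrow> (real^'n \<Rightarrow> real^'n) set"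
    and N :: nat
    and u :: "nat \<Rightarrow> real^'n \<Rightarrow> real"
    and \<sigma> :: "nat \<Rightarrow> real^'n \<Rightarrow> real^'n"
  defines "t \<equiv> graded_mesh N \<gamma> T"
    and "n\<alpha> \<equiv> n_start \<alpha> N"
    and "lamS \<equiv> lambda_S \<Omega> T A b c \<epsilon> lam"
  defines "LamS \<equiv> Lambda_S lamS \<epsilon> lam CI (step_ratio t (n\<alpha> + 1))"
  defines "LamSinf \<equiv> lim (Lambda_seq \<alpha> t n\<alpha> LamS)"
    and "C\<delta> \<equiv> \<delta> / (\<delta> - 1)"
  defines "CS \<equiv> 2 * C\<delta>"
  assumes "CARD('n) \<in> {1, 2, 3}"
    and "polytopal_domain \<Omega>"
    and "0 < \<alpha>" "\<alpha> < 1" "0 < T" "1 \<le> \<gamma>" "1 \<le> N"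
    and "0 < \<kappa>0" "0 < \<kappa>1" "diffusion_matrix \<Omega> T \<kappa>0 \<kappa>1 CA A"
    and "bounded_coeff \<Omega> T Cb b" "bounded_coeff \<Omega> T Cc c"
    and "bounded_int_op \<Omega> CI g"
    and "bochner_W1 3 0 \<Omega> T f" "bochner_W1 2 1 \<Omega> T f" "L2_continuous \<Omega> T f"
    and "u0 \<in> H1_0 \<Omega> \<inter> sobolev 2 \<Omega>"
    and "mixed_fe_family \<Omega> T A H \<T> V W" "h \<in> H"
    and "imex_L1_mixed_fem \<Omega> \<alpha> t N A b c lam g f u0 (V h) (W h) u \<sigma>"
    and "0 < \<epsilon>" "1 < \<delta>"
    and "lamS \<noteq> 0 \<longrightarrow>
           Max (step t ` {1..N}) \<le> (\<delta> * lamS * Gamma (2 - \<alpha>)) powr (- 1 / \<alpha>)"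
  shows "\<forall>n\<in>{1..N}. l2norm \<Omega> (u n) \<le>
           CS * mittag_leffler \<alpha> (C\<delta> * LamSinf * t n powr \<alpha>) *
           (l2norm \<Omega> (u 0) +
            Max ((\<lambda>j. \<Sum>i=1..j. P_kernel \<alpha> t j i *
                    l2norm \<Omega> (\<lambda>x. extrapol t n\<alpha> i (\<lambda>k. f x (t k)))) ` {1..n}))"
proof -
  have \<alpha>: "0 < \<alpha>" "\<alpha> < 1" and N: "1 \<le> N" and \<kappa>0: "0 < \<kappa>0" and \<epsilon>: "0 < \<epsilon>" and \<delta>: "1 < \<delta>"
    and A: "diffusion_matrix \<Omega> T \<kappa>0 \<kappa>1 CA A" and b: "bounded_coeff \<Omega> T Cb b"
    and c: "bounded_coeff \<Omega> T Cc c" and g: "bounded_int_op \<Omega> CI g"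
    and scheme: "imex_L1_mixed_fem \<Omega> \<alpha> t N A b c lam g f u0 (V h) (W h) u \<sigma>"
    using assms by auto
  interpret graded: graded_time_mesh N \<gamma> T by unfold_locales (use assms in auto)
  interpret L1_mesh \<alpha> t
    unfolding t_def by (rule graded.L1_mesh_graded[OF \<alpha>])
  have U: "open \<Omega>" using assms by (simp add: polytopal_domain_def)
  have VW: "V h \<subseteq> L2 \<Omega>" "W h \<subseteq> Hdiv \<Omega>"
    using assms unfolding mixed_fe_family_def by auto
  have m: "1 \<le> n\<alpha>" "real n\<alpha> * \<alpha> \<le> 1"
    unfolding n\<alpha>_def by (rule n_start_bounds[OF \<alpha> N])+
  have t_le_T: "t j \<le> T" if "j \<le> N" for j
    using t_le[OF that] graded.graded_mesh_N by (simp add: t_def)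
  have f: "(\<lambda>x. f x (t j)) \<in> L2 \<Omega>" if "j \<le> N" for j
    using \<open>L2_continuous \<Omega> T f\<close> t_nonneg t_le_T[OF that] by (simp add: L2_continuous_def)
  have u: "u j \<in> L2 \<Omega>" if "j \<le> N" for j
    using scheme VW that unfolding imex_L1_mixed_fem_def by auto
  have steps: "step t i \<le> step t (Suc i)" if "1 \<le> i" for i
    unfolding t_def by (rule graded.step_graded_mono[OF that])
  define r where "r = step_ratio t (n\<alpha> + 1)"
  have ratio: "0 \<le> step_ratio t j" "step_ratio t j \<le> r" if "n\<alpha> < j" for j
    using graded.step_ratio_graded_antimono[of "n\<alpha> + 1" j] graded.step_ratio_graded_ge_1[of j] that m
    by (auto simp: r_def t_def)
  have r: "0 \<le> r" using ratio(1)[of "n\<alpha> + 1"] by (simp add: r_def)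
  \<comment> \<open>The factor \<open>2\<close> is from the bound of the squared extrapolation by the two earlier norms.\<close>
  define \<beta> where "\<beta> = 2 / \<epsilon> * \<bar>lam\<bar> * CI\<^sup>2"
  have \<beta>: "0 \<le> \<beta>" using \<epsilon> by (simp add: \<beta>_def)
  have LamS: "LamS = lamS + \<beta> * (1 + r)\<^sup>2 + \<beta> * r\<^sup>2"
    by (simp add: LamS_def Lambda_S_def \<beta>_def r_def distrib_left)
  have lamS: "0 \<le> lamS"
    using convection_form_time_slice(2)[OF U \<kappa>0 A b] reaction_time_slice(2)[OF U c] \<epsilon>
    by (simp add: lamS_def lambda_S_def)
  have LamS0: "0 \<le> LamS" using lamS \<beta> by (simp add: LamS)
  have Lam_le: "Lambda_seq \<alpha> t n\<alpha> LamS j \<le> LamSinf" for j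
    unfolding LamSinf_def by (rule Lambda_seq_le_lim[OF LamS0 m(1) ratio(2)])
  have C\<delta>: "0 \<le> C\<delta>" using \<delta> by (simp add: C\<delta>_def)
  define \<mu> where "\<mu> = C\<delta> * LamSinf"
  have LamS_le: "LamS \<le> LamSinf" using Lam_le[of 0] by (simp add: Lambda_seq_def)
  have \<mu>0: "0 \<le> \<mu>" using C\<delta> LamS0 LamS_le by (simp add: \<mu>_def)
  define \<xi> where "\<xi> i = l2norm \<Omega> (\<lambda>x. extrapol t n\<alpha> i (\<lambda>k. f x (t k)))" for i
  show ?thesis
  proof
    fix n assume "n \<in> {1..N}"
    then have n: "1 \<le> n" "n \<le> N" by auto
    define F where "F = l2norm \<Omega> (u 0) + Max ((\<lambda>j. \<Sum>i=1..j. P j i * \<xi> i) ` {1..n})"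
    have F: "l2norm \<Omega> (u 0) + (\<Sum>i=1..j. P j i * \<xi> i) \<le> F" if "1 \<le> j" "j \<le> n" for j
      unfolding F_def using that by (intro add_left_mono Max_ge) auto
    have "0 \<le> (\<Sum>i=1..1. P 1 i * \<xi> i)"
      by (intro sum_nonneg mult_nonneg_nonneg P_nonneg) (auto simp: \<xi>_def l2norm_nonneg)
    then have F0: "l2norm \<Omega> (u 0) \<le> F" using F[of 1] n by linarith
    have "l2norm \<Omega> (u n) \<le> 2 * (\<delta> / (\<delta> - 1)) * F * (\<Sum>k\<le>n. \<mu> ^ k * ml_term k n)"
    proof (rule L1_gronwall[where m = n\<alpha> and \<xi> = \<xi> and l = lamS and a = "\<beta> * (1 + r)\<^sup>2" and b = "\<beta> * r\<^sup>2" and n = n])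
      fix j assume j: "1 \<le> j" "j \<le> n"
      then have jN: "j \<le> N" using n by simp
      have tj: "t j \<in> {0<..T}" using t_pos[OF j(1)] t_le_T[OF jN] by simp
      have "D j (\<lambda>i. (l2norm \<Omega> (u i))\<^sup>2) \<le> lamS * (l2norm \<Omega> (u j))\<^sup>2
          + 1 / \<epsilon> * \<bar>lam\<bar> * CI\<^sup>2 * (l2norm \<Omega> (\<lambda>x. extrapol t n\<alpha> j (\<lambda>i. u i x)))\<^sup>2
          + 2 * \<xi> j * l2norm \<Omega> (u j)"
        unfolding lamS_def \<xi>_def n\<alpha>_def
        by (rule imex_energy_inequality[OF L1_mesh_axioms U \<kappa>0 A b c g VW scheme j(1) jN tj
              m(1)[unfolded n\<alpha>_def] f \<epsilon>]) (use jN in auto)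
      also have "1 / \<epsilon> * \<bar>lam\<bar> * CI\<^sup>2 * (l2norm \<Omega> (\<lambda>x. extrapol t n\<alpha> j (\<lambda>i. u i x)))\<^sup>2
          \<le> 1 / \<epsilon> * \<bar>lam\<bar> * CI\<^sup>2 * (2 * ((1 + r)\<^sup>2 * (l2norm \<Omega> (u (j - 1)))\<^sup>2
              + r\<^sup>2 * (l2norm \<Omega> (u (j - 2)))\<^sup>2))"
        by (intro mult_left_mono l2norm_extrapol_sq) (use u jN j m r ratio \<epsilon> in auto)
      finally show "D j (\<lambda>i. (l2norm \<Omega> (u i))\<^sup>2) \<le> lamS * (l2norm \<Omega> (u j))\<^sup>2
          + \<beta> * (1 + r)\<^sup>2 * (l2norm \<Omega> (u (j - 1)))\<^sup>2 + \<beta> * r\<^sup>2 * (l2norm \<Omega> (u (j - 2)))\<^sup>2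
          + 2 * \<xi> j * l2norm \<Omega> (u j)"
        by (simp add: \<beta>_def algebra_simps)
      show "lamS * P j j \<le> 1 / \<delta>"
      proof (cases "lamS = 0")
        case False
        have "step t j \<le> Max (step t ` {1..N})" using j jN by (intro Max_ge) auto
        also have "\<dots> \<le> (\<delta> * lamS * Gamma (2 - \<alpha>)) powr (- 1 / \<alpha>)" using assms False by blast
        finally show ?thesis using False lamS \<delta> j by (intro step_restriction_P_diag) auto
      qed (use \<delta> in auto)
      show "l2norm \<Omega> (u 0) + (\<Sum>i=1..j. P j i * \<xi> i) \<le> F" by (rule F[OF j])
    next
      fix j assume j: "n\<alpha> < j" "j \<le> n"
      have "P j j / P j (j - 1) \<le> Max ((\<lambda>j. P j j / P j (j - 1)) ` {n\<alpha> + 1..j})"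
        using j by (intro Max_ge) auto
      then have "LamS * (1 + P j j / P j (j - 1)) \<le> Lambda_seq \<alpha> t n\<alpha> LamS j"
        using j LamS0 by (auto simp: Lambda_seq_def intro!: mult_left_mono)
      also have "\<dots> \<le> LamSinf" by (rule Lam_le)
      finally show "\<delta> / (\<delta> - 1) * ((lamS + \<beta> * (1 + r)\<^sup>2 + \<beta> * r\<^sup>2) * (1 + P j j / P j (j - 1))) \<le> \<mu>"
        unfolding \<mu>_def LamS C\<delta>_def[symmetric] using C\<delta> by (intro mult_left_mono)
    next
      show "\<delta> / (\<delta> - 1) * (lamS + \<beta> * (1 + r)\<^sup>2 + \<beta> * r\<^sup>2) \<le> \<mu>"
        unfolding \<mu>_def LamS[symmetric] C\<delta>_def[symmetric] using LamS_le C\<delta> by (rule mult_left_mono)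
    qed (use steps lamS \<beta> \<delta> m F0 in \<open>auto simp: \<xi>_def l2norm_nonneg\<close>)
    also have "\<dots> \<le> 2 * (\<delta> / (\<delta> - 1)) * F * mittag_leffler \<alpha> (\<mu> * t n powr \<alpha>)"
    proof (intro mult_left_mono mult_nonneg_nonneg)
      show "(\<Sum>k\<le>n. \<mu> ^ k * ml_term k n) \<le> mittag_leffler \<alpha> (\<mu> * t n powr \<alpha>)"
        using mittag_leffler_ge_partial_sum[OF \<alpha>(1), of "\<mu> * t n powr \<alpha>" n] \<mu>0
        by (simp add: ml_term_def power_mult_distrib)
      show "0 \<le> F" using F0 l2norm_nonneg[of \<Omega> "u 0"] by linarith
    qed (use \<delta> in auto)
    also have "2 * (\<delta> / (\<delta> - 1)) * F * mittag_leffler \<alpha> (\<mu> * t n powr \<alpha>)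
        = CS * mittag_leffler \<alpha> (\<mu> * t n powr \<alpha>) * F"
      by (simp add: CS_def C\<delta>_def)
    finally show "l2norm \<Omega> (u n) \<le> CS * mittag_leffler \<alpha> (C\<delta> * LamSinf * t n powr \<alpha>) *
           (l2norm \<Omega> (u 0) + Max ((\<lambda>j. \<Sum>i=1..j. P j i *
                    l2norm \<Omega> (\<lambda>x. extrapol t n\<alpha> i (\<lambda>k. f x (t k)))) ` {1..n}))"
      unfolding F_def \<xi>_def \<mu>_def .
  qed
qed

end
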